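(* Let $\gamma\in\mathbb C$ be outside the spectrum of $\mu_1$ on $\ell^2(V)$. For every $v\in V$ and $\omega\in\Omega$, writing $h=h(v,v_0,\omega)$, $$K(v,v_0,\omega\,|\,\gamma)=F^+(\gamma)^{-\lceil h/2\rceil}F^-(\gamma)^{-\lfloor h/2\rfloor}=\begin{cases}\bigl(F^+(\gamma)F^-(\gamma)\bigr)^{-h/2}&\text{if }|v|\text{ is even},\\[1mm] \dfrac{(F^+(\gamma)F^-(\gamma))^{-(h-1)/2}}{F^+(\gamma)}=\bigl(F^+(\gamma)F^-(\gamma)\bigr)^{-(h+1)/2}F^-(\gamma)&\text{if }|v|\text{ is odd}.\end{cases}$$ Consequently, as $\gamma\to0$ outside the spectrum of $\mu_1$ on $\ell^2(V)$, $$\lim_{\gamma\to0}K(v,v_0,\omega\,|\,\gamma)=\begin{cases}\Bigl(-\dfrac1{\max\{q_+,q_-\}}\Bigr)^{-h/2}&\text{for every }v\in V_+,\\ 0&\text{for every }v\in V_-,\text{ if }q_+<q_-,\\ \infty&\text{for every }v\in V_-,\text{ if }q_+>q_-.\end{cases}$$ Moreover, the alternative generalized Poisson kernel $\widetilde K(v,v_0,\omega\,|\,\gamma)=\widetilde F(v,j\,|\,\gamma)/\widetilde F(v_0,j\,|\,\gamma)$ (with $j$ any vertex in $[v,\omega)\cap[v_0,\omega)$) satisfies $$\widetilde K(v,v_0,\omega\,|\,\gamma)=\begin{cases}\dfrac{\mathfrak q^{h}}{K(v,v_0,\omega\,|\,\gamma)}&\text{if }|v|\text{ is even},\\[3mm]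 \dfrac{\mathfrak q^{h}}{K(v,v_0,\omega\,|\,\gamma)}\cdot\dfrac{\sqrt{q_-}\,(q_++1)}{\sqrt{q_+}\,(q_-+1)}&\text{if }|v|\text{ is odd},\end{cases}$$ and $\widetilde K(v,v_0,\omega\,|\,1)=1$ for all $v,\omega$.
   Context: Let $q_+,q_-\ge 2$ be integers, and let $T$ be the semi-homogeneous tree: the infinite tree whose vertex set $V$ is the disjoint union of $V_+$ and $V_-$, each vertex of $V_\pm$ having exactly $q_\pm+1$ neighbors, all in $V_\mp$ ($q_+=q_-$ is allowed). Fix $v_0\in V_+$; $|v|=\operatorname{dist}(v,v_0)$, $\mathfrak q=\sqrt{q_+q_-}$; $\mu_1f(v)$ is the average of $f$ over the neighbors of $v$. The boundary $\Omega$ is the set of equivalence classes of rays (one-sided infinite geodesic chains), two rays being equivalent if they eventually merge; $[v,\omega)$ is the unique ray from $v$ in the class $\omega$. The horospherical index is $h(v,v_0,\omega)=\operatorname{dist}(v_0,j)-\operatorname{dist}(v,j)$ for any $j\in[v,\omega)\cap[v_0,\omega)$. Set $Q(\gamma)=(q_++1)(q_-+1)\gamma^2$, $W(\gamma)=Q(\gamma)^2-2(q_++q_-)Q(\gamma)+(q_+-q_-)^2$, $a=\frac{|\sqrt{q_+}-\sqrt{q_-}|}{\sqrt{(q_++1)(q_-+1)}}$, $b=\frac{\sqrt{q_+}+\sqrt{q_-}}{\sqrt{(q_++1)(q_-+1)}}$. Let $R(\gamma)$ be the determination of $\sqrt{W(\gamma)}$ on $\mathbb C\setminus((-b,-a)\cup(a,b))$,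 continuous there, holomorphic off $[-b,-a]\cup[a,b]$, and positive for real $\gamma>b$. Set $$F^\pm(\gamma)=\frac{Q(\gamma)\mp(q_+-q_-)-R(\gamma)}{2q_\mp(q_\pm+1)\gamma},\qquad \widetilde F^\pm(\gamma)=\frac{Q(\gamma)\mp(q_+-q_-)+R(\gamma)}{2q_\mp(q_\pm+1)\gamma}.$$ For neighbors $u\sim w$ with $u\in V_\pm$ put $F(u,w\,|\,\gamma)=F^\pm(\gamma)$, $\widetilde F(u,w\,|\,\gamma)=\widetilde F^\pm(\gamma)$, and extend multiplicatively along geodesic chains: $F(u_0,u_n\,|\,\gamma)=\prod_{i=1}^nF(u_{i-1},u_i\,|\,\gamma)$ (value $1$ if $n=0$), and likewise $\widetilde F$. (For $|\gamma|$ larger than the $\ell^2$-spectral radius, $F(u,w\,|\,\gamma)=\sum_n f^{(n)}(u,w)\gamma^{-n}$, with $f^{(n)}(u,w)$ the probability that the random walk generated by $\mu_1$ from $u$ first visits $w$ at time $n$.) The generalized Poisson kernel is $K(v,v_0,\omega\,|\,\gamma)=F(v,j\,|\,\gamma)/F(v_0,j\,|\,\gamma)$ for any $j\in[v,\omega)\cap[v_0,\omega)$. *)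

theory Defs
  imports "HOL-Analysis.Analysis"
begin

section \<open>The semi-homogeneous tree\<close>

text \<open>
  A graph is given by its adjacency relation \<open>E\<close>, a symmetric set of ordered pairs.
  Bipartiteness (the second assumption below) excludes loops.  As the degrees are positive,
  the condition on \<open>card\<close> also says that every vertex has only finitely many neighbours.
\<close>

definition cycle :: "('v \<times> 'v) set \<Rightarrow> 'v list \<Rightarrow> bool" where
  "cycle E xs \<longleftrightarrow> 3 \<le> length xs \<and> distinct xs \<and>
     successively (\<lambda>x y. (x, y) \<in> E) xs \<and> (last xs, hd xs) \<in> E"

definition semihomogeneous_tree ::
    "nat \<Rightarrow> nat \<Rightarrow> 'v set \<Rightarrow> 'v set \<Rightarrow> ('v \<times> 'v) set \<Rightarrow> bool" where
  "semihomogeneous_tree qp qm Vp Vm E \<longleftrightarrow>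
     Vp \<inter> Vm = {} \<and>
     E \<subseteq> Vp \<times> Vm \<union> Vm \<times> Vp \<and>
     sym E \<and>
     (\<forall>u\<in>Vp \<union> Vm. \<forall>w\<in>Vp \<union> Vm. (u, w) \<in> E\<^sup>*) \<and>
     (\<nexists>xs. cycle E xs) \<and>
     (\<forall>u\<in>Vp. card (E `` {u}) = qp + 1) \<and>
     (\<forall>u\<in>Vm. card (E `` {u}) = qm + 1)"

definition gdist :: "('v \<times> 'v) set \<Rightarrow> 'v \<Rightarrow> 'v \<Rightarrow> nat" where
  "gdist E u w = (LEAST n. (u, w) \<in> E ^^ n)"

definition geodesic_chain :: "('v \<times> 'v) set \<Rightarrow> 'v \<Rightarrow> 'v \<Rightarrow> 'v list" where
  "geodesic_chain E u w =
     (THE xs. length xs = gdist E u w + 1 \<and> hd xs = u \<and> last xs = w \<and>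
              successively (\<lambda>x y. (x, y) \<in> E) xs)"

section \<open>Boundary and horospherical index\<close>

definition ray :: "('v \<times> 'v) set \<Rightarrow> (nat \<Rightarrow> 'v) \<Rightarrow> bool" where
  "ray E r \<longleftrightarrow> (\<forall>n. (r n, r (Suc n)) \<in> E) \<and>
     (\<forall>m n. m \<le> n \<longrightarrow> gdist E (r m) (r n) = n - m)"

definition merge_rel :: "('v \<times> 'v) set \<Rightarrow> ((nat \<Rightarrow> 'v) \<times> (nat \<Rightarrow> 'v)) set" where
  "merge_rel E = {(r, s). ray E r \<and> ray E s \<and> (\<exists>k l. \<forall>n. r (k + n) = s (l + n))}"

definition boundary :: "('v \<times> 'v) set \<Rightarrow> (nat \<Rightarrow> 'v) set set" where
  "boundary E = {r. ray E r} // merge_rel E"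

text \<open>The vertex set of the ray \<open>[v, \<omega>)\<close>.\<close>

definition ray_verts :: "'v \<Rightarrow> (nat \<Rightarrow> 'v) set \<Rightarrow> 'v set" where
  "ray_verts v \<omega> = range (THE r. r \<in> \<omega> \<and> r 0 = v)"

text \<open>
  Quantities computed from "any" vertex \<open>j\<close> common to \<open>[v, \<omega>)\<close> and \<open>[v0, \<omega>)\<close> are defined as
  the unique value attained at all such \<open>j\<close>.
\<close>

definition horo_index :: "('v \<times> 'v) set \<Rightarrow> 'v \<Rightarrow> 'v \<Rightarrow> (nat \<Rightarrow> 'v) set \<Rightarrow> int" where
  "horo_index E v v0 \<omega> =
     (THE h. \<forall>j \<in> ray_verts v \<omega> \<inter> ray_verts v0 \<omega>. h = int (gdist E v0 j) - int (gdist E v j))"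

section \<open>The averaging operator and its spectrum on \<open>\<ell>\<^sup>2(V)\<close>\<close>

definition mu1 :: "('v \<times> 'v) set \<Rightarrow> ('v \<Rightarrow> complex) \<Rightarrow> 'v \<Rightarrow> complex" where
  "mu1 E f v = (\<Sum>w\<in>E `` {v}. f w) / of_nat (card (E `` {v}))"

text \<open>Functions on \<open>V\<close> are represented by their extensions by zero.\<close>

definition ell2 :: "'v set \<Rightarrow> ('v \<Rightarrow> complex) set" where
  "ell2 V = {f. (\<forall>v. v \<notin> V \<longrightarrow> f v = 0) \<and> (\<lambda>v. (cmod (f v))\<^sup>2) summable_on V}"

definition ell2_norm :: "'v set \<Rightarrow> ('v \<Rightarrow> complex) \<Rightarrow> real" where
  "ell2_norm V f = sqrt (\<Sum>\<^sub>\<infinity>v\<in>V. (cmod (f v))\<^sup>2)"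

definition bounded_op_ell2 :: "'v set \<Rightarrow> (('v \<Rightarrow> complex) \<Rightarrow> 'v \<Rightarrow> complex) \<Rightarrow> bool" where
  "bounded_op_ell2 V S \<longleftrightarrow>
     (\<forall>f\<in>ell2 V. S f \<in> ell2 V) \<and>
     (\<forall>f\<in>ell2 V. \<forall>g\<in>ell2 V. S (\<lambda>v. f v + g v) = (\<lambda>v. S f v + S g v)) \<and>
     (\<forall>c. \<forall>f\<in>ell2 V. S (\<lambda>v. c * f v) = (\<lambda>v. c * S f v)) \<and>
     (\<exists>C. \<forall>f\<in>ell2 V. ell2_norm V (S f) \<le> C * ell2_norm V f)"

definition ell2_spectrum :: "'v set \<Rightarrow> (('v \<Rightarrow> complex) \<Rightarrow> 'v \<Rightarrow> complex) \<Rightarrow> complex set" where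
  "ell2_spectrum V T =
     {\<gamma>. \<nexists>S. bounded_op_ell2 V S \<and>
        (\<forall>f\<in>ell2 V. S (\<lambda>v. \<gamma> * f v - T f v) = f \<and> (\<lambda>v. \<gamma> * S f v - T (S f) v) = f)}"

section \<open>The functions \<open>F\<^sup>\<plusminus>\<close> and their companions\<close>

definition Qfun :: "nat \<Rightarrow> nat \<Rightarrow> complex \<Rightarrow> complex" where
  "Qfun qp qm \<gamma> = (of_nat qp + 1) * (of_nat qm + 1) * \<gamma>\<^sup>2"

definition Wfun :: "nat \<Rightarrow> nat \<Rightarrow> complex \<Rightarrow> complex" where
  "Wfun qp qm \<gamma> = (Qfun qp qm \<gamma>)\<^sup>2 - 2 * (of_nat qp + of_nat qm) * Qfun qp qm \<gamma>
                  + (of_nat qp - of_nat qm)\<^sup>2"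

definition cut_a :: "nat \<Rightarrow> nat \<Rightarrow> real" where
  "cut_a qp qm = \<bar>sqrt (real qp) - sqrt (real qm)\<bar> / sqrt ((real qp + 1) * (real qm + 1))"

definition cut_b :: "nat \<Rightarrow> nat \<Rightarrow> real" where
  "cut_b qp qm = (sqrt (real qp) + sqrt (real qm)) / sqrt ((real qp + 1) * (real qm + 1))"

definition open_cuts :: "nat \<Rightarrow> nat \<Rightarrow> complex set" where
  "open_cuts qp qm = complex_of_real `
     ({- cut_b qp qm <..< - cut_a qp qm} \<union> {cut_a qp qm <..< cut_b qp qm})"

definition closed_cuts :: "nat \<Rightarrow> nat \<Rightarrow> complex set" where
  "closed_cuts qp qm = complex_of_real `
     ({- cut_b qp qm .. - cut_a qp qm} \<union> {cut_a qp qm .. cut_b qp qm})"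

text \<open>The conditions determine \<open>R\<close> off \<open>open_cuts\<close>; its values on the open cuts are arbitrary.\<close>

definition sqrtW_determination :: "nat \<Rightarrow> nat \<Rightarrow> (complex \<Rightarrow> complex) \<Rightarrow> bool" where
  "sqrtW_determination qp qm R \<longleftrightarrow>
     (\<forall>\<gamma>\<in>- open_cuts qp qm. (R \<gamma>)\<^sup>2 = Wfun qp qm \<gamma>) \<and>
     continuous_on (- open_cuts qp qm) R \<and>
     R holomorphic_on (- closed_cuts qp qm) \<and>
     (\<forall>x::real. x > cut_b qp qm \<longrightarrow> (\<exists>y>0. R (of_real x) = of_real y))"

text \<open>Existence of the determination (so assuming \<open>sqrtW_determination\<close> is not vacuous).\<close>

lemma Wfun_eq: "Wfun qp qm z = (Qfun qp qm z - (of_nat qp + of_nat qm))\<^sup>2 - 4 * of_nat qp * of_nat qm"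
  by (simp add: Wfun_def power2_eq_square algebra_simps)

lemma Q_in_cut:
  assumes q: "qp > 0" "qm > 0"
    and t: "Qfun qp qm z = of_real t" "(t - (real qp + real qm))\<^sup>2 \<le> 4 * real qp * real qm"
  shows "z \<in> closed_cuts qp qm"
    and "(t - (real qp + real qm))\<^sup>2 < 4 * real qp * real qm \<Longrightarrow> z \<in> open_cuts qp qm"
proof -
  define N where "N = (real qp + 1) * (real qm + 1)"
  have N: "N > 0" by (simp add: N_def add_pos_nonneg)
  define a b where "a = cut_a qp qm" and "b = cut_b qp qm"
  have ab: "a \<ge> 0" "b \<ge> 0" by (auto simp: a_def b_def cut_a_def cut_b_def)
  have a2: "N * a\<^sup>2 = real qp + real qm - 2 * sqrt (real qp * real qm)"
    and b2: "N * b\<^sup>2 = real qp + real qm + 2 * sqrt (real qp * real qm)"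
    using N by (simp_all add: a_def b_def cut_a_def cut_b_def N_def[symmetric] power_divide
        power2_diff power2_sum real_sqrt_mult)
  have Qz: "of_real N * z\<^sup>2 = of_real t" using t(1) by (simp add: Qfun_def N_def)
  have s4: "4 * real qp * real qm = (2 * sqrt (real qp * real qm))\<^sup>2"
    by (simp add: power_mult_distrib)
  have tb: "\<bar>t - (real qp + real qm)\<bar> \<le> 2 * sqrt (real qp * real qm)"
    using t(2) unfolding s4 abs_le_square_iff[symmetric] by simp
  have t0: "t \<ge> N * a\<^sup>2" "t \<le> N * b\<^sup>2" using tb unfolding a2 b2 by linarith+
  hence tn: "t \<ge> 0" using N by (meson order_trans mult_nonneg_nonneg less_imp_le zero_le_power2)
  have z2: "z\<^sup>2 = (of_real (sqrt (t / N)))\<^sup>2"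
    using Qz N tn by (simp add: field_simps flip: of_real_power)
  define x where "x = sqrt (t / N)"
  have z: "z = of_real x \<or> z = of_real (-x)" using z2 by (auto simp: x_def power2_eq_iff)
  have x: "x \<ge> a" "x \<le> b" using t0 N ab by (auto simp: x_def field_simps real_le_rsqrt intro!: real_le_lsqrt)
  show "z \<in> closed_cuts qp qm"
    using z x unfolding closed_cuts_def a_def b_def by auto
  assume "(t - (real qp + real qm))\<^sup>2 < 4 * real qp * real qm"
  hence "\<bar>t - (real qp + real qm)\<bar> < 2 * sqrt (real qp * real qm)"
    unfolding s4 by (metis abs_le_square_iff abs_of_nonneg linorder_not_le mult_nonneg_nonneg of_nat_0_le_iff real_sqrt_ge_zero zero_le_numeral)
  hence t1: "t > N * a\<^sup>2" "t < N * b\<^sup>2" unfolding a2 b2 by linarith+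
  have "x > a" "x < b" using t1 N ab by (auto simp: x_def field_simps real_less_rsqrt intro!: real_less_lsqrt)
  thus "z \<in> open_cuts qp qm"
    using z unfolding open_cuts_def a_def b_def by auto
qed

lemma sqrtW_determination_exists:
  assumes q: "qp > 0" "qm > 0"
  shows "\<exists>R. sqrtW_determination qp qm R"
proof -
  define s p where "s = real qp + real qm" and "p = 4 * real qp * real qm"
  have p: "p > 0" using q by (simp add: p_def)
  define U where "U z = Qfun qp qm z - of_real s" for z
  define R where "R z = U z * csqrt (1 - of_real p / (U z)\<^sup>2)" for z
  have WU: "Wfun qp qm z = (U z)\<^sup>2 - of_real p" for z
    by (simp add: Wfun_eq U_def s_def p_def)
  have QU: "Qfun qp qm z = of_real (u + s)" if "U z = of_real u" for z u
    using that by (simp add: U_def algebra_simps)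
  have U0: "U z \<noteq> 0" if "z \<notin> open_cuts qp qm" for z
  proof
    assume "U z = 0"
    hence "Qfun qp qm z = of_real (0 + s)" using QU[of z 0] by simp
    from Q_in_cut(2)[OF q this] that p show False by (simp add: s_def p_def)
  qed
  have real_case: "\<exists>u. U z = of_real u \<and> u\<^sup>2 \<le> p" if z: "1 - of_real p / (U z)\<^sup>2 \<in> \<real>\<^sub>\<le>\<^sub>0" and "U z \<noteq> 0" for z
  proof -
    obtain x where x: "1 - of_real p / (U z)\<^sup>2 = of_real x" "x \<le> 0"
      using z by (auto elim!: nonpos_Reals_cases)
    hence "of_real p = of_real (1 - x) * (U z)\<^sup>2" using that(2) by (simp add: field_simps)
    hence "(U z)\<^sup>2 = of_real (p / (1 - x))" using x(2) by (simp add: field_simps)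
    also have "\<dots> = (of_real (sqrt (p / (1 - x))))\<^sup>2" using p x by (simp flip: of_real_power)
    finally have "U z = of_real (sqrt (p / (1 - x))) \<or> U z = of_real (- sqrt (p / (1 - x)))"
      by (auto simp: power2_eq_iff)
    moreover have "p / (1 - x) \<le> p" using p x(2) by (simp add: divide_le_eq mult_nonneg_nonpos algebra_simps)
    moreover have "p / (1 - x) \<ge> 0" using p x by simp
    ultimately show ?thesis by (metis power2_minus real_sqrt_pow2)
  qed
  have out: "1 - of_real p / (U z)\<^sup>2 \<notin> \<real>\<^sub>\<le>\<^sub>0" if t: "z \<notin> closed_cuts qp qm" "U z \<noteq> 0" for z
  proof
    assume "1 - of_real p / (U z)\<^sup>2 \<in> \<real>\<^sub>\<le>\<^sub>0"
    then obtain u where u: "U z = of_real u" "u\<^sup>2 \<le> p" using real_case t(2) by blast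
    show False using Q_in_cut(1)[OF q QU[OF u(1)]] u(2) that(1) by (simp add: s_def p_def)
  qed
  have edge: "1 - of_real p / (U z)\<^sup>2 = 0"
    if t: "z \<notin> open_cuts qp qm" "1 - of_real p / (U z)\<^sup>2 \<in> \<real>\<^sub>\<le>\<^sub>0" for z
  proof -
    obtain u where u: "U z = of_real u" "u\<^sup>2 \<le> p" using real_case[OF t(2)] U0[OF t(1)] by blast
    have "\<not> u\<^sup>2 < p"
    proof
      assume "u\<^sup>2 < p"
      hence "z \<in> open_cuts qp qm" using Q_in_cut(2)[OF q QU[OF u(1)]] by (simp add: s_def p_def)
      thus False using t(1) by blast
    qed
    hence "p = u\<^sup>2" using u(2) by linarith
    thus ?thesis using u(1) U0[OF that(1)] by simp
  qed
  have oc: "open_cuts qp qm \<subseteq> closed_cuts qp qm"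
    by (force simp: open_cuts_def closed_cuts_def)
  have contU: "continuous_on A (\<lambda>z. 1 - of_real p / (U z)\<^sup>2)" if "A \<subseteq> - open_cuts qp qm" for A
    using that U0 unfolding U_def Qfun_def by (intro continuous_intros) auto
  have contR: "continuous_on (- open_cuts qp qm) R"
    unfolding continuous_on_eq_continuous_within
  proof
    fix z assume z: "z \<in> - open_cuts qp qm"
    let ?g = "\<lambda>z. 1 - of_real p / (U z)\<^sup>2"
    have g: "continuous (at z within - open_cuts qp qm) ?g"
      using contU[OF order_refl] z by (simp add: continuous_on_eq_continuous_within)
    have "continuous (at z within - open_cuts qp qm) (\<lambda>z. csqrt (?g z))"
    proof (cases "?g z = 0")
      case False
      hence "?g z \<notin> \<real>\<^sub>\<le>\<^sub>0" using edge z by blast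
      thus ?thesis using continuous_within_compose3[OF continuous_at_csqrt g] by blast
    next
      case True
      have "((\<lambda>w. sqrt (cmod (?g w))) \<longlongrightarrow> sqrt (cmod (?g z))) (at z within - open_cuts qp qm)"
        by (rule tendsto_real_sqrt[OF tendsto_norm[OF g[unfolded continuous_within]]])
      hence "((\<lambda>w. csqrt (?g w)) \<longlongrightarrow> 0) (at z within - open_cuts qp qm)"
        using True by (subst tendsto_norm_zero_iff [symmetric]) (simp add: norm_csqrt)
      thus ?thesis using True by (simp add: continuous_within)
    qed
    thus "continuous (at z within - open_cuts qp qm) R"
      unfolding R_def U_def Qfun_def by (intro continuous_intros) (simp_all add: U_def Qfun_def)
  qed
  have holR: "R holomorphic_on (- closed_cuts qp qm)"
  proof -
    have U: "U holomorphic_on (- closed_cuts qp qm)"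
      unfolding U_def Qfun_def by (intro holomorphic_intros)
    have "(\<lambda>z. csqrt (1 - of_real p / (U z)\<^sup>2)) holomorphic_on (- closed_cuts qp qm)"
      using U0 oc out by (intro holomorphic_intros U) auto
    from holomorphic_on_mult[OF U this] show ?thesis unfolding R_def .
  qed
  have posR: "\<exists>y>0. R (of_real x) = of_real y" if x: "x > cut_b qp qm" for x
  proof -
    define N where "N = (real qp + 1) * (real qm + 1)"
    have N: "N > 0" by (simp add: N_def add_pos_nonneg)
    have b0: "cut_b qp qm \<ge> 0" by (simp add: cut_b_def)
    have b2: "N * (cut_b qp qm)\<^sup>2 = s + sqrt p"
      using N by (simp add: cut_b_def N_def[symmetric] power_divide power2_sum real_sqrt_mult s_def p_def)
    define u where "u = N * x\<^sup>2 - s"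
    have "N * x\<^sup>2 > N * (cut_b qp qm)\<^sup>2" using N x b0 by (simp add: power_strict_mono)
    hence u: "u > sqrt p" using b2 by (simp add: u_def)
    have u0: "u > 0" using u p by (meson less_trans real_sqrt_gt_zero)
    have "(sqrt p)\<^sup>2 < u\<^sup>2" using u p by (intro power_strict_mono) auto
    hence up: "p < u\<^sup>2" using p by simp
    have Ux: "U (of_real x) = of_real u" by (simp add: U_def u_def Qfun_def N_def)
    have "1 - p / u\<^sup>2 > 0" using up u0 by simp
    moreover have "R (of_real x) = of_real (u * sqrt (1 - p / u\<^sup>2))"
    proof -
      have c: "1 - of_real p / (of_real u)\<^sup>2 = complex_of_real (1 - p / u\<^sup>2)" by simp
      show ?thesis unfolding R_def Ux c using calculation by simp
    qed
    ultimately show ?thesis using u0 by (metis mult_pos_pos real_sqrt_gt_zero)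
  qed
  have "(R z)\<^sup>2 = Wfun qp qm z" if "z \<in> - open_cuts qp qm" for z
    using U0[of z] that by (simp add: R_def WU power_mult_distrib field_simps)
  thus ?thesis using contR holR posR unfolding sqrtW_determination_def by blast
qed

definition Fplus :: "nat \<Rightarrow> nat \<Rightarrow> (complex \<Rightarrow> complex) \<Rightarrow> complex \<Rightarrow> complex" where
  "Fplus qp qm R \<gamma> = (Qfun qp qm \<gamma> - (of_nat qp - of_nat qm) - R \<gamma>)
                       / (2 * of_nat qm * (of_nat qp + 1) * \<gamma>)"

definition Fminus :: "nat \<Rightarrow> nat \<Rightarrow> (complex \<Rightarrow> complex) \<Rightarrow> complex \<Rightarrow> complex" where
  "Fminus qp qm R \<gamma> = (Qfun qp qm \<gamma> + (of_nat qp - of_nat qm) - R \<gamma>)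
                       / (2 * of_nat qp * (of_nat qm + 1) * \<gamma>)"

definition Ftplus :: "nat \<Rightarrow> nat \<Rightarrow> (complex \<Rightarrow> complex) \<Rightarrow> complex \<Rightarrow> complex" where
  "Ftplus qp qm R \<gamma> = (Qfun qp qm \<gamma> - (of_nat qp - of_nat qm) + R \<gamma>)
                       / (2 * of_nat qm * (of_nat qp + 1) * \<gamma>)"

definition Ftminus :: "nat \<Rightarrow> nat \<Rightarrow> (complex \<Rightarrow> complex) \<Rightarrow> complex \<Rightarrow> complex" where
  "Ftminus qp qm R \<gamma> = (Qfun qp qm \<gamma> + (of_nat qp - of_nat qm) + R \<gamma>)
                       / (2 * of_nat qp * (of_nat qm + 1) * \<gamma>)"

section \<open>Generalized Poisson kernels\<close>

text \<open>
  Multiplicative extension along geodesic chains of an edge function whose value on an edge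
  depends only on the class of its first vertex: \<open>cp\<close> on \<open>Vp\<close>, \<open>cm\<close> on \<open>Vm\<close>.
\<close>

definition chain_prod ::
    "'v set \<Rightarrow> ('v \<times> 'v) set \<Rightarrow> complex \<Rightarrow> complex \<Rightarrow> 'v \<Rightarrow> 'v \<Rightarrow> complex" where
  "chain_prod Vp E cp cm u w =
     prod_list (map (\<lambda>x. if x \<in> Vp then cp else cm) (butlast (geodesic_chain E u w)))"

definition chain_kernel ::
    "'v set \<Rightarrow> ('v \<times> 'v) set \<Rightarrow> complex \<Rightarrow> complex \<Rightarrow> 'v \<Rightarrow> 'v \<Rightarrow> (nat \<Rightarrow> 'v) set \<Rightarrow> complex" where
  "chain_kernel Vp E cp cm v v0 \<omega> =
     (THE k. \<forall>j \<in> ray_verts v \<omega> \<inter> ray_verts v0 \<omega>.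
        k = chain_prod Vp E cp cm v j / chain_prod Vp E cp cm v0 j)"

definition poisson_K ::
    "nat \<Rightarrow> nat \<Rightarrow> (complex \<Rightarrow> complex) \<Rightarrow> 'v set \<Rightarrow> ('v \<times> 'v) set \<Rightarrow>
     'v \<Rightarrow> 'v \<Rightarrow> (nat \<Rightarrow> 'v) set \<Rightarrow> complex \<Rightarrow> complex" where
  "poisson_K qp qm R Vp E v v0 \<omega> \<gamma> =
     chain_kernel Vp E (Fplus qp qm R \<gamma>) (Fminus qp qm R \<gamma>) v v0 \<omega>"

definition poisson_Kt ::
    "nat \<Rightarrow> nat \<Rightarrow> (complex \<Rightarrow> complex) \<Rightarrow> 'v set \<Rightarrow> ('v \<times> 'v) set \<Rightarrow>
     'v \<Rightarrow> 'v \<Rightarrow> (nat \<Rightarrow> 'v) set \<Rightarrow> complex \<Rightarrow> complex" where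
  "poisson_Kt qp qm R Vp E v v0 \<omega> \<gamma> =
     chain_kernel Vp E (Ftplus qp qm R \<gamma>) (Ftminus qp qm R \<gamma>) v v0 \<omega>"

end

theory Submission
  imports Defs
begin

text \<open>
  In a forest a walk without backtracking is the unique one between its ends, so it is the geodesic.
  Hence two rays of the same class merge with a fixed offset, which is the horospherical index,
  and the kernels are products of powers of \<open>F\<^sup>+\<close> and \<open>F\<^sup>-\<close> whose exponents are read off from parities.
  Everything else follows from \<open>Fplus * Ftplus = (q\<^sub>- + 1) / (q\<^sub>- (q\<^sub>+ + 1))\<close>, its mirror image,
  and \<open>Fplus * Fminus = (Q - R - (q\<^sub>+ + q\<^sub>-)) / (2 q\<^sub>+ q\<^sub>-)\<close> with \<open>R 0 = - \<bar>q\<^sub>+ - q\<^sub>-\<bar>\<close>.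

  These formulas need \<open>\<gamma> \<noteq> 0\<close> and \<open>R\<^sup>2 = W\<close>, so the open cuts and \<open>0\<close> have to lie in the spectrum.
  If \<open>\<gamma>\<close> is not in the spectrum, \<open>\<gamma> g - \<mu>\<^sub>1 g = \<delta>\<^sub>x\<close> has a solution \<open>g\<close> in \<open>\<ell>\<^sup>2\<close>.
  The sums \<open>G n\<close> of \<open>g\<close> over the spheres around \<open>x\<close> satisfy a three-term recurrence, and
  \<open>(cmod (G n))\<^sup>2\<close> divided by the size of the sphere tends to 0 by Cauchy-Schwarz. On the open cuts
  the normalized even terms oscillate with constant amplitude; for \<open>\<gamma> = 0\<close> the odd terms are explicit
  and do not decay when \<open>x\<close> lies in the class of smaller degree.
\<close>

section \<open>Reduced walks in a forest\<close>

text \<open>Walks are nonempty vertex lists, so \<open>hd\<close> and \<open>last\<close> are their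
  ends. Only immediate backtracking is forbidden here, not repeated vertices.\<close>

fun reduced_walk :: "('v \<times> 'v) set \<Rightarrow> 'v list \<Rightarrow> bool" where
  "reduced_walk E [] \<longleftrightarrow> False"
| "reduced_walk E [x] \<longleftrightarrow> True"
| "reduced_walk E (x # y # zs) \<longleftrightarrow>
     (x, y) \<in> E \<and> (zs \<noteq> [] \<longrightarrow> x \<noteq> hd zs) \<and> reduced_walk E (y # zs)"

lemma reduced_walk_nonempty [simp]: "reduced_walk E xs \<Longrightarrow> xs \<noteq> []"
  by auto

lemma reduced_walk_tl: "reduced_walk E (x # xs) \<Longrightarrow> xs \<noteq> [] \<Longrightarrow> reduced_walk E xs"
  by (cases xs) auto

lemma reduced_walk_successively: "reduced_walk E xs \<Longrightarrow> successively (\<lambda>x y. (x, y) \<in> E) xs"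
  by (induction E xs rule: reduced_walk.induct) auto

text \<open>Bridges \<open>gdist\<close>, defined by relation powers, and
  \<open>geodesic_chain\<close>, defined by lists.\<close>

lemma relpow_iff_walk:
  "(u, w) \<in> E ^^ n \<longleftrightarrow>
     (\<exists>xs. length xs = Suc n \<and> hd xs = u \<and> last xs = w \<and> successively (\<lambda>x y. (x, y) \<in> E) xs)"
proof (induction n arbitrary: u)
  case 0
  show ?case by (auto simp: length_Suc_conv)
next
  case (Suc n)
  have "(u, w) \<in> E ^^ Suc n \<longleftrightarrow> (\<exists>y. (u, y) \<in> E \<and> (y, w) \<in> E ^^ n)"
    by (metis relpow_Suc_D2 relpow_Suc_I2)
  also have "\<dots> \<longleftrightarrow> (\<exists>xs. length xs = Suc (Suc n) \<and> hd xs = u \<and> last xs = w \<and>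
      successively (\<lambda>x y. (x, y) \<in> E) xs)" (is "?L \<longleftrightarrow> ?R")
  proof
    assume ?L
    then obtain y xs where "(u, y) \<in> E" "length xs = Suc n" "hd xs = y" "last xs = w"
      "successively (\<lambda>x y. (x, y) \<in> E) xs"
      using Suc by auto
    then show ?R
      by (intro exI[of _ "u # xs"]) (auto simp: successively_Cons)
  next
    assume ?R
    then obtain xs where xs: "length xs = Suc (Suc n)" "hd xs = u" "last xs = w"
      "successively (\<lambda>x y. (x, y) \<in> E) xs" by blast
    then obtain x y zs where "xs = x # y # zs" by (auto simp: length_Suc_conv)
    with xs show ?L
      using Suc by (intro exI[of _ y]) (auto intro!: exI[of _ "y # zs"])
  qed
  finally show ?case .
qed

locale forest =
  fixes E :: "('v \<times> 'v) set"
  assumes symE: "sym E"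
    and irrefl: "(x, x) \<notin> E"
    and no_cycle: "\<nexists>xs. cycle E xs"
begin

lemma edge_sym: "(x, y) \<in> E \<Longrightarrow> (y, x) \<in> E"
  using symE by (rule symD)

text \<open>If the first vertex recurred, the part before its recurrence would be a cycle; it has
  length at least 3 because backtracking is excluded.\<close>

lemma reduced_walk_distinct: "reduced_walk E xs \<Longrightarrow> distinct xs"
proof (induction xs rule: induct_list012)
  case (3 x y zs)
  then have red: "reduced_walk E (y # zs)" and xy: "(x, y) \<in> E" and dist: "distinct (y # zs)"
    by auto
  have "x \<notin> set zs"
  proof
    assume "x \<in> set zs"
    then obtain us ws where zs: "zs = us @ x # ws" by (meson split_list)
    have us: "us \<noteq> []" using "3.prems" zs by auto
    have succ: "successively (\<lambda>x y. (x, y) \<in> E) ((x # y # us) @ x # ws)"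
      using reduced_walk_successively[OF "3.prems"] zs by simp
    have "cycle E (x # y # us)"
      unfolding cycle_def
    proof (intro conjI)
      show "3 \<le> length (x # y # us)" using us by (cases us) auto
      show "distinct (x # y # us)" using dist zs irrefl xy by auto
      show "successively (\<lambda>x y. (x, y) \<in> E) (x # y # us)"
        and "(last (x # y # us), hd (x # y # us)) \<in> E"
        using succ unfolding successively_append_iff by auto
    qed
    then show False using no_cycle by blast
  qed
  then show ?case using dist irrefl xy by auto
qed auto

text \<open>The base point is pushed along \<open>xs\<close>, handing one vertex at a time over to
  the other walk.\<close>

lemma reduced_walk_join:
  assumes "reduced_walk E (x # xs)" and "reduced_walk E (x # ys)"
    and "xs \<noteq> [] \<Longrightarrow> ys \<noteq> [] \<Longrightarrow> hd xs \<noteq> hd ys"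
  shows "reduced_walk E (rev xs @ x # ys)"
  using assms
proof (induction xs arbitrary: x ys)
  case (Cons y xs)
  have "reduced_walk E (rev xs @ y # x # ys)"
    using Cons.prems edge_sym by (intro Cons.IH) (auto intro: reduced_walk_tl)
  then show ?case by simp
qed auto

text \<open>If the first steps differed, the walks joined at their common start would form a reduced
  walk with equal ends, against distinctness. The induction strips a common first step.\<close>

lemma reduced_walk_unique:
  assumes "reduced_walk E xs" "reduced_walk E ys" "hd xs = hd ys" "last xs = last ys"
  shows "xs = ys"
  using assms
proof (induction xs arbitrary: ys)
  case (Cons x xs)
  then obtain ys' where ys: "ys = x # ys'" by (cases ys) auto
  have dx: "distinct (x # xs)" and dy: "distinct (x # ys')"
    using reduced_walk_distinct Cons.prems ys by blast+
  show ?case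
  proof (cases "xs = [] \<or> ys' = []")
    case True
    then show ?thesis using dx dy Cons.prems(4) ys
      by (metis distinct.simps(2) last.simps last_in_set)
  next
    case False
    have "hd xs = hd ys'"
    proof (rule ccontr)
      assume "hd xs \<noteq> hd ys'"
      then have "distinct (rev xs @ x # ys')"
        using Cons.prems ys by (intro reduced_walk_distinct reduced_walk_join) auto
      moreover have "last xs = last ys'" using Cons.prems(4) ys False by auto
      ultimately show False
        using False by (metis disjoint_iff distinct_append last_in_set list.set_intros(2) set_rev)
    qed
    then show ?thesis
      using Cons.IH[of ys'] Cons.prems ys False by (auto dest: reduced_walk_tl)
  qed
qed auto

text \<open>The tail is reduced first. Prepending \<open>x\<close> then creates at most one
  backtrack, and cancelling it shortens the walk.\<close>

lemma reduced_walk_exists: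
  assumes "successively (\<lambda>x y. (x, y) \<in> E) xs" "xs \<noteq> []"
  shows "\<exists>ys. reduced_walk E ys \<and> hd ys = hd xs \<and> last ys = last xs \<and>
           (length ys < length xs \<or> ys = xs)"
  using assms
proof (induction xs)
  case (Cons x xs)
  show ?case
  proof (cases "xs = []")
    case True
    then show ?thesis by (intro exI[of _ "[x]"]) auto
  next
    case False
    then obtain ys where ys: "reduced_walk E ys" "hd ys = hd xs" "last ys = last xs"
      "length ys < length xs \<or> ys = xs" using Cons by (auto simp: successively_Cons)
    have edge: "(x, hd ys) \<in> E" using Cons.prems ys False by (simp add: successively_Cons)
    obtain y zs where y: "ys = y # zs" using ys(1) by (cases ys) auto
    show ?thesis
    proof (cases "zs \<noteq> [] \<and> hd zs = x")
      case True
      moreover have "length zs < length xs" using ys(4) y by auto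
      ultimately show ?thesis using ys y False
        by (intro exI[of _ zs]) (auto intro: reduced_walk_tl)
    next
      case False
      then show ?thesis using ys y edge \<open>xs \<noteq> []\<close>
        by (intro exI[of _ "x # ys"]) auto
    qed
  qed
qed auto

text \<open>Yields both the value of \<open>gdist\<close> and the uniqueness required by
  \<open>geodesic_chain\<close>.\<close>

lemma walk_longer_than_reduced:
  assumes "reduced_walk E xs" "successively (\<lambda>x y. (x, y) \<in> E) zs" "zs \<noteq> []"
    "hd zs = hd xs" "last zs = last xs"
  shows "length xs < length zs \<or> zs = xs"
  using reduced_walk_exists[OF assms(2,3)] reduced_walk_unique[OF assms(1)] assms(4,5) by metis

section \<open>Distances and geodesic chains\<close>

lemma gdist_reduced_walk:
  assumes "reduced_walk E xs"
  shows "gdist E (hd xs) (last xs) = length xs - 1"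
  unfolding gdist_def
proof (rule Least_equality)
  show "(hd xs, last xs) \<in> E ^^ (length xs - 1)"
    using assms reduced_walk_successively[OF assms]
    by (auto simp: relpow_iff_walk Suc_pred intro!: exI[of _ xs])
next
  fix n assume "(hd xs, last xs) \<in> E ^^ n"
  then obtain zs where "length zs = Suc n" "hd zs = hd xs" "last zs = last xs"
    "successively (\<lambda>x y. (x, y) \<in> E) zs" unfolding relpow_iff_walk by blast
  then show "length xs - 1 \<le> n"
    using walk_longer_than_reduced[OF assms, of zs] by force
qed

lemma geodesic_chain_reduced_walk:
  assumes "reduced_walk E xs"
  shows "geodesic_chain E (hd xs) (last xs) = xs"
  unfolding geodesic_chain_def gdist_reduced_walk[OF assms]
proof (rule the_equality)
  show "length xs = length xs - 1 + 1 \<and> hd xs = hd xs \<and> last xs = last xs \<and>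
      successively (\<lambda>x y. (x, y) \<in> E) xs"
    using assms reduced_walk_successively[OF assms] by (cases xs) auto
next
  fix zs assume zs: "length zs = length xs - 1 + 1 \<and> hd zs = hd xs \<and> last zs = last xs \<and>
      successively (\<lambda>x y. (x, y) \<in> E) zs"
  moreover have "length zs = length xs" using zs assms by (cases xs) auto
  ultimately show "zs = xs"
    using walk_longer_than_reduced[OF assms, of zs] by force
qed

lemma reduced_walk_of_rtrancl:
  assumes "(u, w) \<in> E\<^sup>*"
  obtains xs where "reduced_walk E xs" "hd xs = u" "last xs = w"
proof -
  obtain n where "(u, w) \<in> E ^^ n" using assms rtrancl_imp_relpow by blast
  then obtain zs where zs: "length zs = Suc n" "hd zs = u" "last zs = w"
      "successively (\<lambda>x y. (x, y) \<in> E) zs" unfolding relpow_iff_walk by blast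
  then show thesis using that reduced_walk_exists[OF zs(4)] by force
qed

lemma reduced_walk_rev: "reduced_walk E xs \<Longrightarrow> reduced_walk E (rev xs)"
  using reduced_walk_join[of "hd xs" "tl xs" "[]"] by (cases xs) auto

lemma reduced_walk_snoc:
  assumes "reduced_walk E (xs @ [y])" "(y, z) \<in> E" "xs \<noteq> [] \<Longrightarrow> last xs \<noteq> z"
  shows "reduced_walk E (xs @ [y, z])"
  using reduced_walk_join[of y "rev xs" "[z]"] reduced_walk_rev[OF assms(1)] assms(2,3)
  by (auto simp: hd_rev)

lemma reduced_walk_butlast:
  assumes "reduced_walk E (xs @ [y])" "xs \<noteq> []"
  shows "reduced_walk E xs"
  using reduced_walk_rev[OF assms(1)] assms(2) reduced_walk_rev[of "rev xs"]
  by (auto dest: reduced_walk_tl)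

section \<open>Rays as infinite reduced walks\<close>

lemma reduced_walk_upt:
  assumes "\<And>n. (r n, r (Suc n)) \<in> E" "\<And>n. r n \<noteq> r (Suc (Suc n))"
  shows "reduced_walk E (map r [m..<m + Suc n])"
proof (induction n arbitrary: m)
  case (Suc n)
  have "map r [m..<m + Suc (Suc n)] = r m # r (Suc m) # map r [Suc (Suc m)..<m + Suc (Suc n)]"
    by (simp add: upt_conv_Cons del: upt_Suc)
  moreover have "map r [Suc m..<Suc m + Suc n] = r (Suc m) # map r [Suc (Suc m)..<m + Suc (Suc n)]"
    by (simp add: upt_conv_Cons del: upt_Suc)
  ultimately show ?case
    using assms Suc[of "Suc m"] by (auto simp: hd_map simp del: upt_Suc)
qed simp

text \<open>Finite segments of a walk without backtracking are geodesic, so the global distance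
  condition becomes a local one that is easy to check for constructed rays.\<close>

lemma ray_iff: "ray E r \<longleftrightarrow> (\<forall>n. (r n, r (Suc n)) \<in> E) \<and> (\<forall>n. r n \<noteq> r (Suc (Suc n)))"
  (is "?L \<longleftrightarrow> ?R")
proof
  assume L: ?L
  have "r n \<noteq> r (Suc (Suc n))" for n
  proof
    assume eq: "r n = r (Suc (Suc n))"
    have "gdist E (r n) (r n) = 0" "gdist E (r n) (r (Suc (Suc n))) = 2"
      using L unfolding ray_def by auto
    then show False using eq by simp
  qed
  then show ?R using L unfolding ray_def by blast
next
  assume R: ?R
  have "gdist E (r m) (r n) = n - m" if "m \<le> n" for m n
    using gdist_reduced_walk[OF reduced_walk_upt[of r m "n - m"]] R that
    by (auto simp: hd_map last_map simp del: upt_Suc)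
  then show ?L using R unfolding ray_def by blast
qed

lemma geodesic_chain_ray:
  assumes "ray E r" "m \<le> n"
  shows "geodesic_chain E (r m) (r n) = map r [m..<Suc n]"
  using geodesic_chain_reduced_walk[OF reduced_walk_upt[of r m "n - m"]] assms ray_iff
  by (auto simp: hd_map last_map simp del: upt_Suc)

lemma ray_shift: "ray E r \<Longrightarrow> ray E (\<lambda>n. r (k + n))"
  unfolding ray_iff by auto

end

section \<open>Rays, the horospherical index and the kernel\<close>

locale bitree =
  fixes qp qm :: nat and Vp Vm :: "'v set" and E :: "('v \<times> 'v) set"
  assumes tree: "semihomogeneous_tree qp qm Vp Vm E"
begin

lemma disjoint: "Vp \<inter> Vm = {}"
  and edges: "E \<subseteq> Vp \<times> Vm \<union> Vm \<times> Vp"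
  and connected: "u \<in> Vp \<union> Vm \<Longrightarrow> w \<in> Vp \<union> Vm \<Longrightarrow> (u, w) \<in> E\<^sup>*"
  and degree_Vp: "u \<in> Vp \<Longrightarrow> card (E `` {u}) = qp + 1"
  and degree_Vm: "u \<in> Vm \<Longrightarrow> card (E `` {u}) = qm + 1"
  using tree unfolding semihomogeneous_tree_def by auto

sublocale forest E
proof
  show "sym E" and "\<nexists>xs. cycle E xs"
    using tree unfolding semihomogeneous_tree_def by auto
  show "(x, x) \<notin> E" for x
    using edges disjoint by blast
qed

text \<open>The symmetry that later reduces the case \<open>qp > qm\<close> to
  \<open>qp \<le> qm\<close>.\<close>

lemma swap: "bitree qm qp Vm Vp E"
  by unfold_locales (use tree in \<open>auto simp: semihomogeneous_tree_def Un_commute Int_commute\<close>)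

lemma edge_Vp: "(u, w) \<in> E \<Longrightarrow> w \<in> Vp \<longleftrightarrow> u \<notin> Vp"
  and edge_in: "(u, w) \<in> E \<Longrightarrow> u \<in> Vp \<union> Vm"
  using edges disjoint by auto

lemma relpow_parity: "(u, w) \<in> E ^^ n \<Longrightarrow> w \<in> Vp \<longleftrightarrow> (u \<in> Vp \<longleftrightarrow> even n)"
  by (induction n arbitrary: w) (auto dest: edge_Vp)

lemma gdist_parity:
  assumes "u \<in> Vp \<union> Vm" "w \<in> Vp \<union> Vm"
  shows "w \<in> Vp \<longleftrightarrow> (u \<in> Vp \<longleftrightarrow> even (gdist E u w))"
proof (rule relpow_parity)
  show "(u, w) \<in> E ^^ gdist E u w"
    unfolding gdist_def using connected[OF assms] rtrancl_imp_relpow LeastI_ex by metis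
qed

lemma ray_in: "ray E r \<Longrightarrow> r n \<in> Vp \<union> Vm"
  unfolding ray_def using edge_in by blast

lemma ray_parity: "ray E r \<Longrightarrow> r n \<in> Vp \<longleftrightarrow> (r 0 \<in> Vp \<longleftrightarrow> even n)"
  by (induction n) (auto simp: ray_def dest: edge_Vp)

section \<open>Merging rays and boundary classes\<close>

lemma equiv_merge: "equiv {r. ray E r} (merge_rel E)"
proof (rule equivI)
  show "merge_rel E \<subseteq> {r. ray E r} \<times> {r. ray E r}"
    by (auto simp: merge_rel_def)
  show "refl_on {r. ray E r} (merge_rel E)"
    by (auto simp: refl_on_def merge_rel_def)
  show "sym (merge_rel E)"
    unfolding merge_rel_def sym_def by clarsimp metis
  show "trans (merge_rel E)"
  proof (rule transI)
    fix r s t assume "(r, s) \<in> merge_rel E" "(s, t) \<in> merge_rel E"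
    then obtain k l k' l' where *: "ray E r" "ray E t"
      "\<And>n. r (k + n) = s (l + n)" "\<And>n. s (k' + n) = t (l' + n)"
      unfolding merge_rel_def by blast
    \<comment> \<open>Both merging identities are used at the vertex \<open>s (l + k' + n)\<close>,
      which lies in both merged tails.\<close>
    have "r ((k + k') + n) = t ((l' + l) + n)" for n
      using *(3)[of "k' + n"] *(4)[of "l + n"] by (simp add: ac_simps)
    then show "(r, t) \<in> merge_rel E" using * unfolding merge_rel_def by blast
  qed
qed

lemma boundary_ray: "\<omega> \<in> boundary E \<Longrightarrow> r \<in> \<omega> \<Longrightarrow> ray E r"
  unfolding boundary_def using equiv_merge in_quotient_imp_subset by blast

lemma boundary_merge:
  assumes "\<omega> \<in> boundary E" "r \<in> \<omega>" "s \<in> \<omega>"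
  obtains k l where "\<And>n. r (k + n) = s (l + n)"
  using quotient_eq_iff[OF equiv_merge, of \<omega> \<omega> r s] assms
  unfolding boundary_def merge_rel_def by blast

lemma boundary_closed:
  assumes "\<omega> \<in> boundary E" "r \<in> \<omega>" "ray E s" "\<And>n. r (k + n) = s (l + n)"
  shows "s \<in> \<omega>"
proof -
  have "(r, s) \<in> merge_rel E"
    using assms boundary_ray unfolding merge_rel_def by blast
  then show ?thesis
    using assms(1,2) equiv_merge unfolding boundary_def by (metis in_quotient_imp_closed)
qed

text \<open>Moves the origin to a neighbour: if the ray starts through \<open>w\<close>, its first
  vertex is dropped; otherwise \<open>w\<close> is prepended, which creates no backtrack.\<close>

lemma boundary_ray_step:
  assumes \<omega>: "\<omega> \<in> boundary E" and r: "r \<in> \<omega>" "r 0 = u" and uw: "(u, w) \<in> E"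
  shows "\<exists>s\<in>\<omega>. s 0 = w"
proof (cases "r 1 = w")
  case True
  have "(\<lambda>n. r (1 + n)) \<in> \<omega>"
    using boundary_closed[OF \<omega> r(1), of "\<lambda>n. r (1 + n)" 1 0]
      ray_shift[OF boundary_ray[OF \<omega> r(1)], of 1] by simp
  then show ?thesis using True by (intro bexI) auto
next
  case False
  define s where "s = (\<lambda>n. case n of 0 \<Rightarrow> w | Suc n \<Rightarrow> r n)"
  have "ray E s"
    using boundary_ray[OF \<omega> r(1)] r(2) uw False edge_sym
    unfolding ray_iff s_def by (auto split: nat.split)
  then have "s \<in> \<omega>"
    using boundary_closed[OF \<omega> r(1), of s 0 1] by (simp add: s_def)
  then show ?thesis by (intro bexI) (simp_all add: s_def)
qed

text \<open>The origin of any representative is moved to \<open>v\<close> along a path, one edge at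
  a time.\<close>

lemma boundary_ray_exists:
  assumes \<omega>: "\<omega> \<in> boundary E" and v: "v \<in> Vp \<union> Vm"
  shows "\<exists>r\<in>\<omega>. r 0 = v"
proof -
  obtain r where r: "r \<in> \<omega>"
    using \<omega> equiv_merge unfolding boundary_def by (metis equals0I in_quotient_imp_non_empty)
  have "(r 0, v) \<in> E\<^sup>*"
    using connected ray_in[OF boundary_ray[OF \<omega> r]] v by blast
  then show ?thesis
  proof induction
    case (step y z)
    then show ?case using boundary_ray_step[OF \<omega>] by blast
  qed (use r in blast)
qed

text \<open>Both initial segments are the geodesic chain between the same two vertices.\<close>

lemma ray_determined:
  assumes "ray E r" "ray E s" "r 0 = s 0" "r k = s l" "n \<le> k"
  shows "k = l" "r n = s n"
proof -
  have "gdist E (r 0) (r k) = k" "gdist E (s 0) (s l) = l"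
    using assms(1,2) unfolding ray_def by auto
  then show kl: "k = l" using assms(3,4) by metis
  have "map r [0..<Suc k] = map s [0..<Suc k]"
    using geodesic_chain_ray[OF assms(1), of 0 k] geodesic_chain_ray[OF assms(2), of 0 k] assms kl
    by auto
  then show "r n = s n" using assms(5) by (simp add: map_eq_conv del: upt_Suc)
qed

text \<open>Makes the definite description in \<open>ray_verts\<close> meaningful. The merged tails
  supply a common vertex at or beyond any position \<open>n\<close>, and up to it the rays
  agree.\<close>

lemma boundary_ray_unique:
  assumes "\<omega> \<in> boundary E" "r \<in> \<omega>" "s \<in> \<omega>" "r 0 = s 0"
  shows "r = s"
proof
  fix n
  obtain k l where kl: "\<And>n. r (k + n) = s (l + n)"
    using boundary_merge[OF assms(1-3)] by blast
  show "r n = s n"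
    using ray_determined(2)[OF _ _ assms(4) kl[of n]] boundary_ray assms by simp
qed

lemma ray_verts_eq:
  assumes "\<omega> \<in> boundary E" "r \<in> \<omega>"
  shows "ray_verts (r 0) \<omega> = range r"
proof -
  have "(THE s. s \<in> \<omega> \<and> s 0 = r 0) = r"
    using assms boundary_ray_unique by (intro the_equality) auto
  then show ?thesis unfolding ray_verts_def by simp
qed

text \<open>The offset is the same at all common vertices, since the distance to a far vertex of the
  merged tail can be measured along either ray.\<close>

lemma merge_offset:
  assumes "ray E r" "ray E s" "\<And>n. r (k + n) = s (l + n)" "r i = s j"
  shows "int j - int i = int l - int k"
proof -
  \<comment> \<open>Adding \<open>i + j\<close> puts the far vertex beyond both positions, so the
    natural subtractions are not truncated.\<close>
  have 1: "k + (i + j) - i = l + (i + j) - j"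
  proof -
    have "gdist E (r i) (r (k + (i + j))) = k + (i + j) - i"
      using assms(1) unfolding ray_def by auto
    moreover have "gdist E (s j) (s (l + (i + j))) = l + (i + j) - j"
      using assms(2) unfolding ray_def by auto
    ultimately show ?thesis using assms(3,4) by simp
  qed
  then show ?thesis by simp
qed

section \<open>The horospherical index and the kernel in terms of rays\<close>

text \<open>The classes alternate, so among the \<open>n\<close> vertices before \<open>r n\<close>
  the class of \<open>r 0\<close> occurs \<open>Suc n div 2\<close> times and the other one
  \<open>n div 2\<close> times.\<close>

lemma chain_prod_ray:
  assumes "ray E r"
  shows "chain_prod Vp E cp cm (r 0) (r n) =
    (if r 0 \<in> Vp then cp ^ (Suc n div 2) * cm ^ (n div 2)
     else cp ^ (n div 2) * cm ^ (Suc n div 2))"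
proof -
  have "prod_list (map (\<lambda>x. if x \<in> Vp then cp else cm) (map r [0..<n])) =
    (if r 0 \<in> Vp then cp ^ (Suc n div 2) * cm ^ (n div 2)
     else cp ^ (n div 2) * cm ^ (Suc n div 2))"
  proof (induction n)
    case (Suc n)
    then show ?case
      using ray_parity[OF assms, of n] by (auto elim!: evenE oddE)
  qed simp
  then show ?thesis
    unfolding chain_prod_def geodesic_chain_ray[OF assms le0] by simp
qed

text \<open>The quotient is a monomial in \<open>cp\<close> and \<open>cm\<close>. Its exponents
  depend on \<open>i\<close> and \<open>j\<close> only through \<open>h\<close>, because the class
  of \<open>v\<close> fixes whether \<open>i\<close> and \<open>j\<close> have equal parity.\<close>

lemma kernel_on_common_vertex:
  assumes v: "r 0 = v" and v0: "s 0 = v0" "v0 \<in> Vp"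
    and rays: "ray E r" "ray E s" and ij: "r i = s j"
    and h: "h = int j - int i" and nz: "cp \<noteq> 0" "cm \<noteq> 0"
  shows "even h \<longleftrightarrow> v \<in> Vp"
    and "chain_prod Vp E cp cm v (r i) / chain_prod Vp E cp cm v0 (r i) =
      cp powi (- ((h + 1) div 2)) * cm powi (- (h div 2))"
proof -
  have par: "v \<in> Vp \<longleftrightarrow> (even i \<longleftrightarrow> even j)"
    using ray_parity[OF rays(1), of i] ray_parity[OF rays(2), of j] ij v v0 by auto
  then show "even h \<longleftrightarrow> v \<in> Vp" by (auto simp: h)
  have s: "chain_prod Vp E cp cm v0 (r i) = cp ^ (Suc j div 2) * cm ^ (j div 2)"
    using chain_prod_ray[OF rays(2)] v0 ij by auto
  have r: "chain_prod Vp E cp cm v (r i) = (if v \<in> Vp then cp ^ (Suc i div 2) * cm ^ (i div 2)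
     else cp ^ (i div 2) * cm ^ (Suc i div 2))"
    using chain_prod_ray[OF rays(1)] v by auto
  have diff: "c powi (int m - int n) = c ^ m / c ^ n" if "c \<noteq> 0" for c :: complex and m n
    using that by (simp add: power_int_diff)
  show "chain_prod Vp E cp cm v (r i) / chain_prod Vp E cp cm v0 (r i) =
      cp powi (- ((h + 1) div 2)) * cm powi (- (h div 2))"
  proof (cases "v \<in> Vp")
    case True
    have e1: "- ((h + 1) div 2) = int (Suc i div 2) - int (Suc j div 2)"
      and e2: "- (h div 2) = int (i div 2) - int (j div 2)"
      using True par unfolding h by presburger+
    then show ?thesis using True by (simp only: r s e1 e2 diff[OF nz(1)] diff[OF nz(2)] if_True) simp
  next
    case False
    have e1: "- ((h + 1) div 2) = int (i div 2) - int (Suc j div 2)"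
      and e2: "- (h div 2) = int (Suc i div 2) - int (j div 2)"
      using False par unfolding h by presburger+
    then show ?thesis using False by (simp only: r s e1 e2 diff[OF nz(1)] diff[OF nz(2)] if_False) simp
  qed
qed

text \<open>Discharges the definite descriptions: the candidate value is attained at every common
  vertex, and \<open>r k\<close> is one, so no other value qualifies.\<close>

lemma
  assumes \<omega>: "\<omega> \<in> boundary E" and v: "v \<in> Vp \<union> Vm" and v0: "v0 \<in> Vp"
  shows horo_index_parity: "even (horo_index E v v0 \<omega>) \<longleftrightarrow> v \<in> Vp"
    and chain_kernel_eq: "cp \<noteq> 0 \<Longrightarrow> cm \<noteq> 0 \<Longrightarrow> chain_kernel Vp E cp cm v v0 \<omega> =
      cp powi (- ((horo_index E v v0 \<omega> + 1) div 2)) * cm powi (- (horo_index E v v0 \<omega> div 2))"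
proof -
  obtain r where r: "r \<in> \<omega>" "r 0 = v" "ray E r"
    using boundary_ray_exists[OF \<omega> v] boundary_ray[OF \<omega>] by blast
  obtain s where s: "s \<in> \<omega>" "s 0 = v0" "ray E s"
    using boundary_ray_exists[OF \<omega>] v0 boundary_ray[OF \<omega>] by blast
  obtain k l where kl: "\<And>n. r (k + n) = s (l + n)"
    using boundary_merge[OF \<omega> r(1) s(1)] by blast
  have vr: "ray_verts v \<omega> = range r" and vs: "ray_verts v0 \<omega> = range s"
    using ray_verts_eq[OF \<omega>] r s by blast+
  have common: "r k \<in> ray_verts v \<omega> \<inter> ray_verts v0 \<omega>"
    using kl[of 0] vr vs by (metis IntI add_0_right rangeI)
  define h where "h = int l - int k"
  have off: "int j - int i = h" if "r i = s j" for i j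
    using merge_offset[OF r(3) s(3) kl that] by (simp add: h_def)
  have horo: "horo_index E v v0 \<omega> = h"
    unfolding horo_index_def
  proof (rule the_equality)
    have idx: "h = int (gdist E v0 x) - int (gdist E v x)"
      if x: "x \<in> ray_verts v \<omega> \<inter> ray_verts v0 \<omega>" for x
    proof -
      obtain i j where "x = r i" "x = s j" using x vr vs by (metis IntE imageE)
      moreover have "gdist E (r 0) (r i) = i" "gdist E (s 0) (s j) = j"
        using r s unfolding ray_def by auto
      ultimately show ?thesis using off r s by metis
    qed
    then show "\<forall>j\<in>ray_verts v \<omega> \<inter> ray_verts v0 \<omega>. h = int (gdist E v0 j) - int (gdist E v j)"
      by blast
    fix h' assume "\<forall>j\<in>ray_verts v \<omega> \<inter> ray_verts v0 \<omega>. h' = int (gdist E v0 j) - int (gdist E v j)"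
    then show "h' = h" using idx common by metis
  qed
  \<comment> \<open>The parity claim does not mention the edge values, so \<open>1\<close> is
    supplied for both.\<close>
  show "even (horo_index E v v0 \<omega>) \<longleftrightarrow> v \<in> Vp"
    unfolding horo
    using kernel_on_common_vertex(1)[OF r(2) s(2) v0 r(3) s(3) kl[of 0], of h 1 1] h_def by simp
  assume nz: "cp \<noteq> 0" "cm \<noteq> 0"
  let ?K = "cp powi (- ((h + 1) div 2)) * cm powi (- (h div 2))"
  have val: "?K = chain_prod Vp E cp cm v x / chain_prod Vp E cp cm v0 x"
    if xv: "x \<in> ray_verts v \<omega> \<inter> ray_verts v0 \<omega>" for x
  proof -
    obtain i j where x: "x = r i" "r i = s j" using xv vr vs by (metis IntE imageE)
    show ?thesis
      using kernel_on_common_vertex(2)[OF r(2) s(2) v0 r(3) s(3) x(2) _ nz, of h] off[OF x(2)] x(1)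
      by simp
  qed
  show "chain_kernel Vp E cp cm v v0 \<omega> = cp powi (- ((horo_index E v v0 \<omega> + 1) div 2)) *
      cm powi (- (horo_index E v v0 \<omega> div 2))"
    unfolding chain_kernel_def horo
  proof (rule the_equality)
    show "\<forall>j\<in>ray_verts v \<omega> \<inter> ray_verts v0 \<omega>.
       ?K = chain_prod Vp E cp cm v j / chain_prod Vp E cp cm v0 j"
      using val by blast
    fix k' assume "\<forall>j\<in>ray_verts v \<omega> \<inter> ray_verts v0 \<omega>.
       k' = chain_prod Vp E cp cm v j / chain_prod Vp E cp cm v0 j"
    then show "k' = ?K" using val common by metis
  qed
qed

end

section \<open>The spectrum contains the open cuts and the origin\<close>

context bitree begin

section \<open>Spheres around a vertex and their sizes\<close>

lemma degree_pos: "u \<in> Vp \<union> Vm \<Longrightarrow> card (E `` {u}) > 0"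
  using degree_Vp degree_Vm by auto

lemma finite_nbrs: "u \<in> Vp \<union> Vm \<Longrightarrow> finite (E `` {u})"
  using degree_pos card_gt_0_iff by blast

text \<open>The sphere of radius \<open>n\<close>. It is restricted to vertices because
  \<open>gdist\<close> to an unreachable point is an unspecified \<open>LEAST\<close>.\<close>

definition level :: "'v \<Rightarrow> nat \<Rightarrow> 'v set" where
  "level x n = {v \<in> Vp \<union> Vm. gdist E x v = n}"

lemma level_in: "v \<in> level x n \<Longrightarrow> v \<in> Vp \<union> Vm"
  by (simp add: level_def)

lemma level_disjoint: "v \<in> level x n \<Longrightarrow> v \<in> level x m \<Longrightarrow> m = n"
  by (simp add: level_def)

lemma level_walk:
  assumes "reduced_walk E (xs @ [v])" "v \<in> Vp \<union> Vm"
  shows "v \<in> level (hd (xs @ [v])) (length xs)"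
  using gdist_reduced_walk[OF assms(1)] assms(2) by (simp add: level_def)

lemma level_obtain_walk:
  assumes "x \<in> Vp \<union> Vm" "v \<in> level x n"
  obtains xs where "reduced_walk E (xs @ [v])" "hd (xs @ [v]) = x" "length xs = n"
proof -
  obtain ys where ys: "reduced_walk E ys" "hd ys = x" "last ys = v"
    using reduced_walk_of_rtrancl connected assms level_in by metis
  then have eq: "ys = butlast ys @ [v]" by (metis append_butlast_last_id reduced_walk_nonempty)
  have "v \<in> level x (length (butlast ys))"
    using level_walk[of "butlast ys" v] ys eq assms level_in by metis
  then show thesis using that[of "butlast ys"] ys eq assms level_disjoint by metis
qed

lemma level_0:
  assumes "x \<in> Vp \<union> Vm"
  shows "level x 0 = {x}"
proof -
  have "v = x" if "v \<in> level x 0" for v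
    using level_obtain_walk[OF assms that] by auto
  moreover have "x \<in> level x 0" using level_walk[of "[]" x] assms by simp
  ultimately show ?thesis by blast
qed

lemma level_0_nbr:
  assumes "x \<in> Vp \<union> Vm" "(x, w) \<in> E"
  shows "w \<in> level x 1"
  using level_walk[of "[x]" w] assms edge_in edge_sym by auto

text \<open>The neighbour towards \<open>x\<close> is the predecessor on the reduced walk from
  \<open>x\<close>; every other neighbour extends that walk without backtracking.\<close>

lemma level_Suc_nbrs:
  assumes x: "x \<in> Vp \<union> Vm" and v: "v \<in> level x (Suc n)"
  shows "\<exists>u. (v, u) \<in> E \<and> u \<in> level x n \<and> (\<forall>w. (v, w) \<in> E \<longrightarrow> w \<noteq> u \<longrightarrow> w \<in> level x (Suc (Suc n)))"
proof -
  obtain xs where xs: "reduced_walk E (xs @ [v])" "hd (xs @ [v]) = x" "length xs = Suc n"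
    using level_obtain_walk[OF x v] .
  have ne: "xs \<noteq> []" using xs by auto
  define u where "u = last xs"
  have eq: "xs = butlast xs @ [u]" using ne by (simp add: u_def)
  have "reduced_walk E xs" using reduced_walk_butlast[OF xs(1) ne] .
  have uv: "(u, v) \<in> E"
    using reduced_walk_successively[OF xs(1)] ne by (simp add: successively_append_iff u_def)
  have "u \<in> level x n"
    using level_walk[of "butlast xs" u] \<open>reduced_walk E xs\<close> eq xs uv edge_in ne
    by (metis diff_Suc_1 hd_append2 length_butlast)
  moreover have "w \<in> level x (Suc (Suc n))" if "(v, w) \<in> E" "w \<noteq> u" for w
    using level_walk[of "xs @ [v]" w] reduced_walk_snoc[OF xs(1) that(1)] that xs ne
      edge_in edge_sym by (auto simp: u_def)
  ultimately show ?thesis using uv edge_sym by blast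
qed

text \<open>The number of neighbours one step farther from a centre in \<open>Vp\<close>: the degree
  minus the edge back, which only the centre lacks.\<close>

definition branching :: "nat \<Rightarrow> nat" where
  "branching n = (if n = 0 then qp + 1 else if even n then qp else qm)"

lemma level_parity: "x \<in> Vp \<Longrightarrow> v \<in> level x n \<Longrightarrow> v \<in> Vp \<longleftrightarrow> even n"
  using gdist_parity[of x v] by (auto simp: level_def)

lemma card_nbrs: "x \<in> Vp \<Longrightarrow> v \<in> level x n \<Longrightarrow> card (E `` {v}) = (if even n then qp else qm) + 1"
  using level_parity[of x v n] degree_Vp[of v] degree_Vm[of v] level_in[of v x n] by auto

lemma card_level_nbrs_down:
  assumes x: "x \<in> Vp \<union> Vm" and v: "v \<in> level x (Suc n)"
  shows "card (E `` {v} \<inter> level x n) = 1"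
proof -
  obtain u where u: "(v, u) \<in> E" "u \<in> level x n"
    "\<And>w. (v, w) \<in> E \<Longrightarrow> w \<noteq> u \<Longrightarrow> w \<in> level x (Suc (Suc n))"
    using level_Suc_nbrs[OF x v] by blast
  have "E `` {v} \<inter> level x n = {u}"
    using u level_disjoint[of _ x n "Suc (Suc n)"] by auto
  then show ?thesis by simp
qed

lemma card_level_nbrs_up:
  assumes x: "x \<in> Vp" and v: "v \<in> level x n"
  shows "card (E `` {v} \<inter> level x (Suc n)) = branching n"
proof (cases n)
  case 0
  then have "v = x" using level_0 v x by auto
  then have "E `` {v} \<inter> level x (Suc n) = E `` {v}" using level_0_nbr[of x] x 0 by auto
  then show ?thesis using card_nbrs[OF x v] 0 by (simp add: branching_def)
next
  case (Suc m)
  obtain u where u: "(v, u) \<in> E" "u \<in> level x m"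
    "\<And>w. (v, w) \<in> E \<Longrightarrow> w \<noteq> u \<Longrightarrow> w \<in> level x (Suc (Suc m))"
    using level_Suc_nbrs[of x v m] x v Suc by blast
  have "E `` {v} \<inter> level x (Suc n) = E `` {v} - {u}"
    using u Suc level_disjoint[of u x m "Suc (Suc m)"] by auto
  then show ?thesis using card_nbrs[OF x v] u Suc by (simp add: branching_def)
qed

lemma level_nbrs_split:
  assumes x: "x \<in> Vp \<union> Vm" and v: "v \<in> level x (Suc n)"
  shows "E `` {v} = (E `` {v} \<inter> level x n) \<union> (E `` {v} \<inter> level x (Suc (Suc n)))"
  using level_Suc_nbrs[OF x v] by blast

lemma finite_level: "x \<in> Vp \<union> Vm \<Longrightarrow> finite (level x n)"
proof (induction n)
  case (Suc n)
  have "level x (Suc n) \<subseteq> (\<Union>v\<in>level x n. E `` {v})"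
    using level_Suc_nbrs[OF Suc.prems] edge_sym by blast
  then show ?case using Suc finite_nbrs level_in by (meson finite_UN finite_subset)
qed (simp add: level_0)

text \<open>Double counting of the edges between two spheres.\<close>

lemma sum_level_nbrs:
  fixes g :: "'v \<Rightarrow> 'a :: comm_semiring_1"
  assumes "x \<in> Vp \<union> Vm"
  shows "(\<Sum>v\<in>level x n. \<Sum>w\<in>E `` {v} \<inter> level x m. g w) =
    (\<Sum>w\<in>level x m. of_nat (card (E `` {w} \<inter> level x n)) * g w)"
proof -
  have "E `` {v} \<inter> level x m = {w \<in> level x m. (v, w) \<in> E}" for v by auto
  moreover have "E `` {w} \<inter> level x n = {v \<in> level x n. (v, w) \<in> E}" for w
    using edge_sym by auto
  ultimately show ?thesis
    using sum.swap_restrict[OF finite_level[OF assms] finite_level[OF assms],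
        where g = "\<lambda>v w. g w" and R = "\<lambda>v w. (v, w) \<in> E"] by simp
qed

text \<open>The edges between consecutive spheres are counted from both sides; each outer vertex
  carries exactly one.\<close>

lemma card_level_Suc:
  assumes x: "x \<in> Vp"
  shows "card (level x (Suc n)) = branching n * card (level x n)"
proof -
  have xV: "x \<in> Vp \<union> Vm" using x by simp
  have "(\<Sum>v\<in>level x (Suc n). card (E `` {v} \<inter> level x n)) =
      (\<Sum>w\<in>level x n. card (E `` {w} \<inter> level x (Suc n)))"
    using sum_level_nbrs[OF xV, where g = "\<lambda>_. 1::nat"] by simp
  moreover have "(\<Sum>v\<in>level x (Suc n). card (E `` {v} \<inter> level x n)) = card (level x (Suc n))"
    using card_level_nbrs_down[OF xV] by simp
  moreover have "(\<Sum>w\<in>level x n. card (E `` {w} \<inter> level x (Suc n))) = card (level x n) * branching n"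
    using card_level_nbrs_up[OF x] by simp
  ultimately show ?thesis by simp
qed

lemma card_level_odd: "x \<in> Vp \<Longrightarrow> card (level x (2 * k + 1)) = (qp + 1) * (qp * qm) ^ k"
proof (induction k)
  case (Suc k)
  then show ?case
    using card_level_Suc[OF Suc.prems, of "2 * k + 1"] card_level_Suc[OF Suc.prems, of "2 * k + 2"]
    by (simp add: branching_def algebra_simps)
qed (simp add: card_level_Suc level_0 branching_def)

lemma card_level_even: "x \<in> Vp \<Longrightarrow> card (level x (2 * k + 2)) = (qp + 1) * qm * (qp * qm) ^ k"
  using card_level_odd[of x k] card_level_Suc[of x "2 * k + 1"] by (simp add: branching_def algebra_simps)

section \<open>Sphere sums: recurrence and decay\<close>

text \<open>The equation is multiplied by the degree and summed over a sphere. In the sum over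
  radius \<open>n + 1\<close> a vertex at radius \<open>n\<close> is counted
  \<open>branching n\<close> times, one at radius \<open>n + 2\<close> once.\<close>

lemma level_sum_recurrence:
  assumes x: "x \<in> Vp"
    and g: "\<And>v. v \<in> Vp \<union> Vm \<Longrightarrow> \<gamma> * g v - mu1 E g v = (if v = x then 1 else 0)"
  defines "G \<equiv> \<lambda>n. \<Sum>v\<in>level x n. g v"
  shows "\<gamma> * (of_nat qp + 1) * G 0 - G 1 = of_nat qp + 1"
    and "\<gamma> * (of_nat (if even n then qm else qp) + 1) * G (Suc n) =
      of_nat (branching n) * G n + G (Suc (Suc n))"
proof -
  have xV: "x \<in> Vp \<union> Vm" using x by simp
  have deg: "mu1 E g v * of_nat (card (E `` {v})) = (\<Sum>w\<in>E `` {v}. g w)" if "v \<in> Vp \<union> Vm" for v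
    unfolding mu1_def using degree_pos[OF that] by simp
  have "E `` {x} = level x 1"
  proof
    show "level x 1 \<subseteq> E `` {x}"
    proof
      fix w assume "w \<in> level x 1"
      then obtain u where "(w, u) \<in> E" "u \<in> level x 0"
        using level_Suc_nbrs[OF xV, of w 0] by auto
      then show "w \<in> E `` {x}" using level_0[OF xV] edge_sym by simp
    qed
  qed (use level_0_nbr[OF xV] in blast)
  then have G1: "G 1 = mu1 E g x * (of_nat qp + 1)"
    using deg[OF xV] degree_Vp[OF x] by (simp add: G_def add.commute)
  have "(\<gamma> * g x - mu1 E g x) * (of_nat qp + 1) = of_nat qp + 1"
    using g[OF xV] by simp
  moreover have G0: "G 0 = g x" by (simp add: G_def level_0[OF xV])
  ultimately show "\<gamma> * (of_nat qp + 1) * G 0 - G 1 = of_nat qp + 1"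
    unfolding G0 G1 by (simp add: algebra_simps)
  let ?d = "of_nat (if even n then qm else qp) + 1 :: complex"
  have loc: "\<gamma> * ?d * g v = (\<Sum>w\<in>E `` {v} \<inter> level x n. g w) +
      (\<Sum>w\<in>E `` {v} \<inter> level x (Suc (Suc n)). g w)"
    if v: "v \<in> level x (Suc n)" for v
  proof -
    have "v \<noteq> x" using v level_disjoint[of v x 0 "Suc n"] level_0[OF xV] by auto
    then have eq: "\<gamma> * g v = mu1 E g v" using g[OF level_in[OF v]] by simp
    have d: "of_nat (card (E `` {v})) = ?d" using card_nbrs[OF x v] by simp
    have "\<gamma> * ?d * g v = \<gamma> * g v * ?d" by (simp only: ac_simps)
    also have "\<dots> = (\<Sum>w\<in>E `` {v}. g w)"
      using deg[OF level_in[OF v]] unfolding eq d .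
    also have "\<dots> = (\<Sum>w\<in>E `` {v} \<inter> level x n. g w) +
      (\<Sum>w\<in>E `` {v} \<inter> level x (Suc (Suc n)). g w)"
      unfolding arg_cong[OF level_nbrs_split[OF xV v], of "sum g"]
    proof (rule sum.union_disjoint)
      show "(E `` {v} \<inter> level x n) \<inter> (E `` {v} \<inter> level x (Suc (Suc n))) = {}"
        using level_disjoint[of _ x n "Suc (Suc n)"] by auto
    qed (use finite_nbrs[OF level_in[OF v]] in auto)
    finally show ?thesis .
  qed
  have "\<gamma> * ?d * G (Suc n) = (\<Sum>v\<in>level x (Suc n). \<Sum>w\<in>E `` {v} \<inter> level x n. g w) +
      (\<Sum>v\<in>level x (Suc n). \<Sum>w\<in>E `` {v} \<inter> level x (Suc (Suc n)). g w)"
    unfolding G_def sum_distrib_left sum.distrib[symmetric] by (rule sum.cong) (use loc in auto)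
  also have "\<dots> = of_nat (branching n) * G n + G (Suc (Suc n))"
    unfolding sum_level_nbrs[OF xV] G_def
    using card_level_nbrs_up[OF x] card_level_nbrs_down[OF xV] by (simp add: sum_distrib_left)
  finally show "\<gamma> * ?d * G (Suc n) = of_nat (branching n) * G n + G (Suc (Suc n))" .
qed

text \<open>By Cauchy-Schwarz the quotient is at most the sum of \<open>(cmod (g v))\<^sup>2\<close>
  over the sphere; as spheres are disjoint, these bounds form a convergent series.\<close>

lemma level_sum_decay:
  assumes x: "x \<in> Vp \<union> Vm" and g: "g \<in> ell2 (Vp \<union> Vm)"
  shows "(\<lambda>n. (cmod (\<Sum>v\<in>level x n. g v))\<^sup>2 / card (level x n)) \<longlonglongrightarrow> 0"
proof -
  define a where "a n = (\<Sum>v\<in>level x n. (cmod (g v))\<^sup>2)" for n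
  have summ: "(\<lambda>v. (cmod (g v))\<^sup>2) summable_on (Vp \<union> Vm)" using g by (simp add: ell2_def)
  have "summable a"
  proof (rule bounded_imp_summable)
    show "0 \<le> a n" for n by (simp add: a_def sum_nonneg)
    fix n
    have "sum a {..n} = (\<Sum>v\<in>(\<Union>k\<le>n. level x k). (cmod (g v))\<^sup>2)"
      unfolding a_def using finite_level[OF x] level_disjoint
      by (subst sum.UNION_disjoint) (auto simp: disjoint_iff)
    also have "\<dots> \<le> (\<Sum>\<^sub>\<infinity>v\<in>Vp \<union> Vm. (cmod (g v))\<^sup>2)"
      using finite_level[OF x] level_in by (intro finite_sum_le_infsum[OF summ]) auto
    finally show "sum a {..n} \<le> (\<Sum>\<^sub>\<infinity>v\<in>Vp \<union> Vm. (cmod (g v))\<^sup>2)" .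
  qed
  then have lim: "a \<longlonglongrightarrow> 0" by (rule summable_LIMSEQ_zero)
  have bound: "(cmod (\<Sum>v\<in>level x n. g v))\<^sup>2 / card (level x n) \<le> a n" for n
  proof -
    have "(cmod (\<Sum>v\<in>level x n. g v))\<^sup>2 \<le> (\<Sum>v\<in>level x n. cmod (g v) * 1)\<^sup>2"
      by (intro power_mono) (auto intro: norm_sum)
    also have "\<dots> \<le> a n * (\<Sum>v\<in>level x n. 1\<^sup>2)"
      unfolding a_def by (rule Cauchy_Schwarz_ineq_sum)
    finally show ?thesis
      by (cases "card (level x n) = 0") (auto simp: divide_le_eq a_def sum_nonneg)
  qed
  show ?thesis
    by (rule tendsto_sandwich[OF _ _ tendsto_const lim]) (use bound in auto)
qed

end

text \<open>For \<bar>\<tau>\<bar> < 2 the characteristic roots are distinct and lie on the unit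
  circle, so a nonzero solution cannot decay.\<close>

lemma oscillating_recurrence_zero:
  fixes H :: "nat \<Rightarrow> complex" and \<tau> :: real
  assumes \<tau>: "\<bar>\<tau>\<bar> < 2" and rec: "\<And>k. H (Suc (Suc k)) = of_real \<tau> * H (Suc k) - H k"
    and lim: "H \<longlonglongrightarrow> 0"
  shows "H k = 0"
proof -
  \<comment> \<open>\<open>I\<close> is conserved by the recurrence and positive definite because \<open>\<bar>\<tau>\<bar> < 2\<close>.\<close>
  define I where "I k = (cmod (H (Suc k)))\<^sup>2 + (cmod (H k))\<^sup>2 - \<tau> * Re (H (Suc k) * cnj (H k))" for k
  have step: "I (Suc k) = I k" for k
    unfolding I_def rec cmod_power2 by (simp add: power2_eq_square algebra_simps)
  have I0: "I n = I 0" for n by (induction n) (simp_all add: step)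
  have I_const: "I = (\<lambda>_. I 0)" using I0 by (rule ext)
  have "I \<longlonglongrightarrow> 0\<^sup>2 + 0\<^sup>2 - \<tau> * Re (0 * cnj 0)"
    unfolding I_def
    by (intro tendsto_intros tendsto_norm_zero lim LIMSEQ_Suc[OF lim])
  then have "(\<lambda>_. I 0) \<longlonglongrightarrow> 0" by (subst (asm) I_const) simp
  then have "I k = 0" unfolding I0[of k] by (simp add: tendsto_const_iff)
  moreover have "I k \<ge> (1 - \<bar>\<tau>\<bar> / 2) * (cmod (H k))\<^sup>2"
  proof -
    have "\<tau> * Re (H (Suc k) * cnj (H k)) \<le> \<bar>\<tau>\<bar> * \<bar>Re (H (Suc k) * cnj (H k))\<bar>"
      by (metis abs_ge_self abs_mult)
    also have "\<dots> \<le> \<bar>\<tau>\<bar> * cmod (H (Suc k) * cnj (H k))"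
      by (intro mult_left_mono abs_Re_le_cmod abs_ge_zero)
    also have "\<dots> = \<bar>\<tau>\<bar> * (cmod (H (Suc k)) * cmod (H k))"
      by (simp add: norm_mult)
    also have "\<dots> \<le> \<bar>\<tau>\<bar> * (((cmod (H (Suc k)))\<^sup>2 + (cmod (H k))\<^sup>2) / 2)"
      using sum_squares_bound[of "cmod (H (Suc k))" "cmod (H k)"] by (intro mult_left_mono) auto
    finally have "I k \<ge> (1 - \<bar>\<tau>\<bar> / 2) * ((cmod (H (Suc k)))\<^sup>2 + (cmod (H k))\<^sup>2)"
      unfolding I_def by (simp add: algebra_simps)
    moreover have "(1 - \<bar>\<tau>\<bar> / 2) * ((cmod (H (Suc k)))\<^sup>2 + (cmod (H k))\<^sup>2) \<ge> (1 - \<bar>\<tau>\<bar> / 2) * (cmod (H k))\<^sup>2"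
      using \<tau> by (intro mult_left_mono) auto
    ultimately show ?thesis by linarith
  qed
  ultimately have "(1 - \<bar>\<tau>\<bar> / 2) * (cmod (H k))\<^sup>2 \<le> 0" by simp
  then show ?thesis using \<tau> by (simp add: mult_le_0_iff)
qed

context bitree begin

section \<open>Exhibiting points of the spectrum\<close>

lemma Vm_nonempty:
  assumes "x \<in> Vp"
  obtains y where "y \<in> Vm"
proof -
  have "E `` {x} \<noteq> {}" using degree_Vp[OF assms] by (metis card.empty add_is_0 one_neq_zero)
  then show thesis using that edges assms disjoint by auto
qed

text \<open>\<open>g\<close> is the Green function with pole \<open>x\<close>: the resolvent applied
  to the point mass.\<close>

lemma resolvent_of_delta:
  assumes "\<gamma> \<notin> ell2_spectrum (Vp \<union> Vm) (mu1 E)" "x \<in> Vp \<union> Vm"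
  obtains g where "g \<in> ell2 (Vp \<union> Vm)" "\<And>v. \<gamma> * g v - mu1 E g v = (if v = x then 1 else 0)"
proof -
  let ?\<delta> = "\<lambda>v. if v = x then 1 else (0::complex)"
  have "(\<lambda>v. (cmod (?\<delta> v))\<^sup>2) summable_on Vp \<union> Vm"
    by (rule finite_nonzero_values_imp_summable_on, rule finite_subset[of _ "{x}"]) auto
  then have \<delta>: "?\<delta> \<in> ell2 (Vp \<union> Vm)" using assms(2) by (auto simp: ell2_def)
  obtain S where S: "bounded_op_ell2 (Vp \<union> Vm) S"
    "\<And>f. f \<in> ell2 (Vp \<union> Vm) \<Longrightarrow> (\<lambda>v. \<gamma> * S f v - mu1 E (S f) v) = f"
    using assms(1) unfolding ell2_spectrum_def by blast
  have "S ?\<delta> \<in> ell2 (Vp \<union> Vm)" using S(1) \<delta> unfolding bounded_op_ell2_def by blast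
  then show thesis using that S(2)[OF \<delta>] by metis
qed

text \<open>At 0 the odd radii decouple from the even ones. The squared sum over radius
  \<open>2 * k + 1\<close>, divided by the sphere size, is \<open>(qp + 1) * (qm / qp) ^ k\<close>,
  which stays at least 1.\<close>

lemma zero_in_spectrum_if_le:
  assumes q: "qp > 0" "qp \<le> qm" and x: "x \<in> Vp"
  shows "0 \<in> ell2_spectrum (Vp \<union> Vm) (mu1 E)"
proof (rule ccontr)
  assume "0 \<notin> ell2_spectrum (Vp \<union> Vm) (mu1 E)"
  then obtain g where g: "g \<in> ell2 (Vp \<union> Vm)" "\<And>v. 0 * g v - mu1 E g v = (if v = x then 1 else 0)"
    using resolvent_of_delta[of 0 x] x by blast
  define G where "G n = (\<Sum>v\<in>level x n. g v)" for n
  note rec = level_sum_recurrence[OF x g(2), folded G_def]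
  have G: "G (2 * k + 1) = - (of_nat qp + 1) * (- of_nat qm) ^ k" for k
  proof (induction k)
    case 0
    then show ?case using rec(1) by simp (metis add.inverse_inverse minus_add_distrib uminus_add_conv_diff add.commute)
  next
    case (Suc k)
    have "0 = of_nat qm * G (2 * k + 1) + G (2 * k + 3)"
      using rec(2)[of "2 * k + 1"] by (simp add: branching_def numeral_3_eq_3)
    then have "G (2 * k + 3) = - of_nat qm * G (2 * k + 1)" by (simp add: eq_neg_iff_add_eq_0 add.commute)
    then show ?case using Suc by (simp add: numeral_3_eq_3)
  qed
  have ge: "1 \<le> (cmod (G (2 * k + 1)))\<^sup>2 / card (level x (2 * k + 1))" for k
  proof -
    have c: "cmod (G (2 * k + 1)) = (real qp + 1) * real qm ^ k"
      unfolding G norm_mult norm_power norm_minus_cancel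
      using norm_of_nat[of "Suc qp", where ?'a = complex] by (simp add: add.commute)
    have "(real qp * real qm) ^ k \<le> (real qm * real qm) ^ k"
      using q by (intro power_mono mult_right_mono) auto
    also have "\<dots> \<le> (real qp + 1) * (real qm * real qm) ^ k"
      by (simp add: mult_le_cancel_right1)
    finally have "(real qp + 1) * (real qp * real qm) ^ k \<le> (real qp + 1) * ((real qp + 1) * (real qm * real qm) ^ k)"
      by (intro mult_left_mono) auto
    also have "\<dots> = (cmod (G (2 * k + 1)))\<^sup>2"
      unfolding c by (simp add: power2_eq_square power_mult_distrib algebra_simps)
    finally show ?thesis
      unfolding card_level_odd[OF x] using q by (simp add: le_divide_eq add_pos_nonneg distrib_right)
  qed
  have "(\<lambda>k. (cmod (G (2 * k + 1)))\<^sup>2 / card (level x (2 * k + 1))) \<longlonglongrightarrow> 0"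
    using LIMSEQ_subseq_LIMSEQ[OF level_sum_decay[OF _ g(1), of x], of "\<lambda>k. 2 * k + 1"] x
    by (simp add: o_def G_def strict_mono_def)
  then have "1 \<le> (0::real)" by (rule LIMSEQ_le_const) (use ge in blast)
  then show False by simp
qed

text \<open>The normalized sums over even radii decay and oscillate, hence vanish from radius 2 on.
  Substituting inwards kills \<open>G 3\<close>, \<open>G 1\<close> and \<open>G 0\<close>,
  contradicting the equation at the centre.\<close>

lemma open_cuts_in_spectrum:
  assumes q: "qp > 0" "qm > 0" and x: "x \<in> Vp"
  shows "open_cuts qp qm \<subseteq> ell2_spectrum (Vp \<union> Vm) (mu1 E)"
proof (rule subsetI, rule ccontr)
  fix \<gamma> assume \<gamma>: "\<gamma> \<in> open_cuts qp qm" and "\<gamma> \<notin> ell2_spectrum (Vp \<union> Vm) (mu1 E)"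
  then obtain g where g: "g \<in> ell2 (Vp \<union> Vm)" "\<And>v. \<gamma> * g v - mu1 E g v = (if v = x then 1 else 0)"
    using resolvent_of_delta[of \<gamma> x] x by blast
  define P s N where "P = real qp * real qm" and "s = real qp + real qm"
    and "N = (real qp + 1) * (real qm + 1)"
  have P: "P > 0" using q by (simp add: P_def)
  have N: "N > 0" by (simp add: N_def add_pos_nonneg)
  have ab: "cut_a qp qm \<ge> 0" by (simp add: cut_a_def)
  obtain y where y': "\<gamma> = of_real y" "y \<in> {- cut_b qp qm <..< - cut_a qp qm} \<union> {cut_a qp qm <..< cut_b qp qm}"
    using \<gamma> unfolding open_cuts_def by blast
  have y: "\<gamma> = of_real y" "cut_a qp qm < \<bar>y\<bar>" "\<bar>y\<bar> < cut_b qp qm"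
    using y' ab by auto
  have y0: "y \<noteq> 0" using y(2) ab by auto
  define \<tau> where "\<tau> = (N * y\<^sup>2 - s) / sqrt P"
  \<comment> \<open>The ends of the cuts are the points where \<open>N * y\<^sup>2 - s\<close>
    equals \<open>2 * sqrt P\<close> up to sign, so the open cuts correspond to \<bar>\<tau>\<bar> <
    2.\<close>
  have "N * (cut_a qp qm)\<^sup>2 = s - 2 * sqrt P" and "N * (cut_b qp qm)\<^sup>2 = s + 2 * sqrt P"
    using N by (simp_all add: cut_a_def cut_b_def N_def[symmetric] power_divide
        power2_diff power2_sum real_sqrt_mult s_def P_def)
  moreover have "(cut_a qp qm)\<^sup>2 < y\<^sup>2" "y\<^sup>2 < (cut_b qp qm)\<^sup>2"
    using y ab power_strict_mono[of "cut_a qp qm" "\<bar>y\<bar>" 2] power_strict_mono[of "\<bar>y\<bar>" "cut_b qp qm" 2]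
    by simp_all
  then have "N * (cut_a qp qm)\<^sup>2 < N * y\<^sup>2" "N * y\<^sup>2 < N * (cut_b qp qm)\<^sup>2" using N by simp_all
  ultimately have "\<bar>N * y\<^sup>2 - s\<bar> < 2 * sqrt P" by linarith
  then have \<tau>: "\<bar>\<tau>\<bar> < 2" using P by (simp add: \<tau>_def divide_less_eq)
  define G where "G n = (\<Sum>v\<in>level x n. g v)" for n
  note rec = level_sum_recurrence[OF x g(2), folded G_def]
  define \<alpha> \<beta> where "\<alpha> = \<gamma> * (of_nat qp + 1)" and "\<beta> = \<gamma> * (of_nat qm + 1)"
  have r0: "\<alpha> * G 0 - G 1 = of_nat qp + 1" using rec(1) by (simp add: \<alpha>_def)
  have r1: "\<beta> * G 1 = (of_nat qp + 1) * G 0 + G 2"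
    using rec(2)[of 0] by (simp add: \<beta>_def branching_def eval_nat_numeral)
  have num: "3 = Suc (Suc (Suc 0))" "4 = Suc (Suc (Suc (Suc 0)))" "5 = Suc (Suc (Suc (Suc (Suc 0))))"
    "6 = Suc (Suc (Suc (Suc (Suc (Suc 0)))))"
    by simp_all
  have re: "\<alpha> * G (2 * k + 2) = of_nat qm * G (2 * k + 1) + G (2 * k + 3)" for k
    using rec(2)[of "2 * k + 1"] by (simp add: \<alpha>_def branching_def num)
  have ro: "\<beta> * G (2 * k + 3) = of_nat qp * G (2 * k + 2) + G (2 * k + 4)" for k
    using rec(2)[of "2 * k + 2"] by (simp add: \<beta>_def branching_def num)
  \<comment> \<open>Odd radii are eliminated. The recurrence starts at radius 2, since at the centre
    \<open>branching\<close> is \<open>qp + 1\<close> and not \<open>qp\<close>.\<close>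
  have two: "G (2 * k + 6) = of_real (N * y\<^sup>2 - s) * G (2 * k + 4) - of_real P * G (2 * k + 2)" for k
  proof -
    have 6: "G (2 * k + 6) = \<beta> * G (2 * k + 5) - of_nat qp * G (2 * k + 4)"
      using ro[of "Suc k"] by (simp add: num)
    have 5: "G (2 * k + 5) = \<alpha> * G (2 * k + 4) - of_nat qm * G (2 * k + 3)"
      using re[of "Suc k"] by (simp add: num)
    have "G (2 * k + 6) = \<alpha> * \<beta> * G (2 * k + 4) - of_nat qm * (\<beta> * G (2 * k + 3)) - of_nat qp * G (2 * k + 4)"
      unfolding 6 5 by (simp only: algebra_simps)
    also have "\<dots> = (\<alpha> * \<beta> - (of_nat qp + of_nat qm)) * G (2 * k + 4) - of_nat qp * of_nat qm * G (2 * k + 2)"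
      unfolding ro by (simp only: algebra_simps)
    also have "\<alpha> * \<beta> - (of_nat qp + of_nat qm) = of_real (N * y\<^sup>2 - s)"
      by (simp add: N_def \<alpha>_def \<beta>_def y(1) power2_eq_square s_def)
    finally show ?thesis by (simp add: P_def)
  qed
  define c where "c = complex_of_real (sqrt P)"
  have c: "c \<noteq> 0" "c\<^sup>2 = of_real P" using P by (simp_all add: c_def flip: of_real_power)
  \<comment> \<open>The sphere of radius \<open>2 * k + 2\<close> has \<open>C * P ^ k\<close>
    vertices with \<open>C\<close> constant, so dividing by \<open>c ^ k\<close> matches the decay
    estimate and makes the last coefficient of the recurrence -1.\<close>
  define H where "H k = G (2 * k + 2) / c ^ k" for k
  have Hrec: "H (Suc (Suc k)) = of_real \<tau> * H (Suc k) - H k" for k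
  proof -
    have t: "of_real (N * y\<^sup>2 - s) = c * of_real \<tau>"
      using P by (simp add: \<tau>_def c_def flip: of_real_mult)
    have 1: "G (2 * Suc (Suc k) + 2) = c * of_real \<tau> * G (2 * k + 4) - c\<^sup>2 * G (2 * k + 2)"
      using two[of k] unfolding t c(2) by (simp add: num)
    have 2: "G (2 * Suc k + 2) = G (2 * k + 4)" by (simp add: num)
    show ?thesis
      unfolding H_def 1 2 using c(1) by (simp add: diff_divide_distrib power2_eq_square)
  qed
  define C where "C = real ((qp + 1) * qm)"
  have C: "C \<noteq> 0" unfolding C_def using q by (simp only: of_nat_eq_0_iff) simp
  have Hnorm: "(cmod (H k))\<^sup>2 = C * ((cmod (G (2 * k + 2)))\<^sup>2 / card (level x (2 * k + 2)))" for k
  proof -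
    have "(cmod (c ^ k))\<^sup>2 = P ^ k"
    proof -
      have "(cmod (c ^ k))\<^sup>2 = (cmod (c\<^sup>2)) ^ k" by (simp add: norm_power mult.commute flip: power_mult)
      also have "cmod (c\<^sup>2) = P" unfolding c(2) using P by simp
      finally show ?thesis .
    qed
    then have "(cmod (H k))\<^sup>2 = (cmod (G (2 * k + 2)))\<^sup>2 / P ^ k"
      by (simp add: H_def norm_divide power_divide)
    also have "\<dots> = C * ((cmod (G (2 * k + 2)))\<^sup>2 / (C * P ^ k))"
      using C by simp
    also have "C * P ^ k = card (level x (2 * k + 2))"
      unfolding card_level_even[OF x] P_def C_def by simp
    finally show ?thesis .
  qed
  have "(\<lambda>k. (cmod (H k))\<^sup>2) \<longlonglongrightarrow> C * 0"
    unfolding Hnorm using LIMSEQ_subseq_LIMSEQ[OF level_sum_decay[OF _ g(1), of x], of "\<lambda>k. 2 * k + 2"] x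
    by (intro tendsto_mult tendsto_const) (simp add: o_def G_def strict_mono_def)
  then have "(\<lambda>k. sqrt ((cmod (H k))\<^sup>2)) \<longlonglongrightarrow> sqrt 0" by (intro tendsto_real_sqrt) simp
  then have "H \<longlonglongrightarrow> 0" by (simp add: tendsto_norm_zero_iff)
  then have "H k = 0" for k by (rule oscillating_recurrence_zero[where H = H, OF \<tau> Hrec])
  then have G0: "G (2 * k + 2) = 0" for k using c unfolding H_def by (metis divide_eq_0_iff power_not_zero)
  have \<beta>: "\<beta> \<noteq> 0" unfolding \<beta>_def y(1) using y0 of_nat_neq_0[of qm, where ?'a = complex]
    by (simp add: add.commute)
  have "G 3 = 0" using ro[of 0] G0[of 0] G0[of 1] \<beta> by simp
  then have G1: "G 1 = 0" using re[of 0] G0[of 0] q by simp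
  then have "(of_nat qp + 1) * G 0 = 0" using r1 G0[of 0] by (simp add: numeral_2_eq_2)
  moreover have qp1: "of_nat qp + 1 \<noteq> (0::complex)"
    using of_nat_neq_0[of qp, where ?'a = complex] by (simp add: add.commute)
  ultimately have "G 0 = 0" by simp
  then show False using r0 G1 qp1 by simp
qed

lemma zero_in_spectrum:
  assumes "qp > 0" "qm > 0" and x: "x \<in> Vp"
  shows "0 \<in> ell2_spectrum (Vp \<union> Vm) (mu1 E)"
proof (cases "qp \<le> qm")
  case False
  \<comment> \<open>Here \<open>qm < qp\<close>, so the centre is taken in the other class.\<close>
  obtain y where "y \<in> Vm" using Vm_nonempty[OF x] .
  then show ?thesis
    using bitree.zero_in_spectrum_if_le[OF swap, of y] assms False by (simp add: Un_commute)
qed (use assms zero_in_spectrum_if_le in blast)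

end

section \<open>The functions \<open>R\<close> and \<open>F\<close>\<close>

lemma of_nat_add_one_neq_0: "of_nat n + 1 \<noteq> (0 :: complex)"
  using of_nat_neq_0[of n, where ?'a = complex] by (simp add: add.commute)

text \<open>\<open>Qfun\<close> and \<open>Wfun\<close> are symmetric in the two degrees, so the
  same \<open>R\<close> serves after the exchange and plus identities give minus identities.\<close>

lemma Fplus_swap: "Fplus qm qp = Fminus qp qm"
  and Ftplus_swap: "Ftplus qm qp = Ftminus qp qm"
  and Wfun_swap: "Wfun qm qp = Wfun qp qm"
  by (auto simp: fun_eq_iff Fplus_def Fminus_def Ftplus_def Ftminus_def Qfun_def Wfun_def
      algebra_simps power2_eq_square)

section \<open>Product identities\<close>

text \<open>The numerators are conjugate in \<open>R\<close>; with \<open>R\<^sup>2 = W\<close>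
  their product is \<open>4 * qm * Q\<close>, and \<open>Q\<close> cancels the square of \<gamma>
  below.\<close>

lemma Fplus_mult_Ftplus:
  assumes "qp > 0" "qm > 0" "\<gamma> \<noteq> 0" "(R \<gamma>)\<^sup>2 = Wfun qp qm \<gamma>"
  shows "Fplus qp qm R \<gamma> * Ftplus qp qm R \<gamma> =
    (of_nat qm + 1) / (of_nat qm * (of_nat qp + 1))"
proof -
  define Q where "Q = Qfun qp qm \<gamma>"
  have "(Q - (of_nat qp - of_nat qm) - R \<gamma>) * (Q - (of_nat qp - of_nat qm) + R \<gamma>) =
      (Q - (of_nat qp - of_nat qm))\<^sup>2 - (R \<gamma>)\<^sup>2"
    by (simp add: power2_eq_square algebra_simps)
  also have "\<dots> = 4 * of_nat qm * Q"
    unfolding assms(4) Wfun_def Q_def[symmetric] by (simp add: power2_eq_square algebra_simps)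
  finally have num: "(Q - (of_nat qp - of_nat qm) - R \<gamma>) * (Q - (of_nat qp - of_nat qm) + R \<gamma>) =
      4 * of_nat qm * ((of_nat qp + 1) * (of_nat qm + 1) * \<gamma>\<^sup>2)" by (simp add: Q_def Qfun_def)
  show ?thesis
    unfolding Fplus_def Ftplus_def Q_def[symmetric] times_divide_times_eq num
    using assms(1-3) of_nat_add_one_neq_0[of qp] of_nat_add_one_neq_0[of qm]
    by (simp add: divide_simps power2_eq_square)
qed

lemma Fminus_mult_Ftminus:
  assumes "qp > 0" "qm > 0" "\<gamma> \<noteq> 0" "(R \<gamma>)\<^sup>2 = Wfun qp qm \<gamma>"
  shows "Fminus qp qm R \<gamma> * Ftminus qp qm R \<gamma> =
    (of_nat qp + 1) / (of_nat qp * (of_nat qm + 1))"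
  using Fplus_mult_Ftplus[of qm qp \<gamma> R] assms by (simp add: Fplus_swap Ftplus_swap Wfun_swap)

text \<open>Replacing \<open>R\<^sup>2\<close> by \<open>W\<close> makes \<open>Q\<close> a factor
  of the numerator. It cancels the square of \<gamma>, so the product has a limit at 0 even where a
  single factor blows up.\<close>

lemma Fplus_mult_Fminus:
  assumes "qp > 0" "qm > 0" "\<gamma> \<noteq> 0" "(R \<gamma>)\<^sup>2 = Wfun qp qm \<gamma>"
  shows "Fplus qp qm R \<gamma> * Fminus qp qm R \<gamma> =
    (Qfun qp qm \<gamma> - R \<gamma> - (of_nat qp + of_nat qm)) / (2 * of_nat qp * of_nat qm)"
proof -
  define Q where "Q = Qfun qp qm \<gamma>"
  have "(Q - (of_nat qp - of_nat qm) - R \<gamma>) * (Q + (of_nat qp - of_nat qm) - R \<gamma>) =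
      Q\<^sup>2 - 2 * Q * R \<gamma> + (R \<gamma>)\<^sup>2 - (of_nat qp - of_nat qm)\<^sup>2"
    by (simp add: power2_eq_square algebra_simps)
  also have "\<dots> = 2 * Q * (Q - R \<gamma> - (of_nat qp + of_nat qm))"
    unfolding assms(4) Wfun_def Q_def[symmetric] by (simp add: power2_eq_square algebra_simps)
  finally have num: "(Q - (of_nat qp - of_nat qm) - R \<gamma>) * (Q + (of_nat qp - of_nat qm) - R \<gamma>) =
      2 * ((of_nat qp + 1) * (of_nat qm + 1) * \<gamma>\<^sup>2) * (Q - R \<gamma> - (of_nat qp + of_nat qm))"
    by (simp add: Q_def Qfun_def)
  have cancel: "2 * (A * B * \<gamma>\<^sup>2) * X / (2 * m * A * \<gamma> * (2 * p * B * \<gamma>)) = X / (2 * p * m)"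
    if "A \<noteq> 0" "B \<noteq> 0" "m \<noteq> 0" "p \<noteq> 0" for A B X m p :: complex
    using that assms(3) by (simp add: divide_simps power2_eq_square)
  show ?thesis
    unfolding Fplus_def Fminus_def Q_def[symmetric] times_divide_times_eq num
    using assms(1,2) of_nat_add_one_neq_0[of qp] of_nat_add_one_neq_0[of qm]
    by (intro cancel) auto
qed

section \<open>The values of \<open>R\<close> at 0 and 1\<close>

lemma cut_b_square:
  "(real qp + 1) * (real qm + 1) * (cut_b qp qm)\<^sup>2 = real qp + real qm + 2 * sqrt (real qp * real qm)"
proof -
  define N where "N = (real qp + 1) * (real qm + 1)"
  have "N > 0" by (simp add: N_def add_pos_nonneg)
  then show ?thesis
    by (simp add: cut_b_def N_def[symmetric] power_divide power2_sum real_sqrt_mult)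
qed

lemma cuts_nonneg: "0 \<le> cut_a qp qm" "cut_a qp qm \<le> cut_b qp qm"
  unfolding cut_a_def cut_b_def by (auto intro!: divide_right_mono simp: abs_if)

lemma zero_notin_open_cuts: "0 \<notin> open_cuts qp qm"
  using cuts_nonneg[of qp qm] unfolding open_cuts_def by auto

text \<open>
  With \<open>U = Q - s\<close> the square of \<open>R / U\<close> is \<open>1 - p / U\<^sup>2\<close>, which avoids the nonpositive reals off the
  cuts. Hence \<open>Re (R / U)\<close> keeps its sign on a connected set that joins large real arguments to 0.
\<close>

lemma sqrtW_determination_at_0:
  assumes q: "qp > 0" "qm > 0" and R: "sqrtW_determination qp qm R"
  shows "R 0 = - of_real \<bar>real qp - real qm\<bar>"
proof -
  have sq: "(R z)\<^sup>2 = Wfun qp qm z" if "z \<notin> open_cuts qp qm" for z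
    using R that unfolding sqrtW_determination_def by auto
  \<comment> \<open>This fixes \<open>R 0\<close> up to sign; the rest of the proof decides the
    sign.\<close>
  have R0: "(R 0)\<^sup>2 = (of_real \<bar>real qp - real qm\<bar>)\<^sup>2"
  proof -
    have "(complex_of_real \<bar>real qp - real qm\<bar>)\<^sup>2 = (of_nat qp - of_nat qm)\<^sup>2"
      by (simp only: of_real_power[symmetric] power2_abs) simp
    then show ?thesis using sq[OF zero_notin_open_cuts] by (simp add: Wfun_def Qfun_def)
  qed
  show ?thesis
  proof (cases "qp = qm")
    case True
    then show ?thesis using R0 by simp
  next
    case False
    define s p where "s = real qp + real qm" and "p = 4 * real qp * real qm"
    have s: "s > 0" and p: "p > 0" using q by (simp_all add: s_def p_def)
    have a: "cut_a qp qm > 0" using False by (simp add: cut_a_def add_pos_nonneg)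
    define U where "U z = Qfun qp qm z - of_real s" for z
    \<comment> \<open>The open upper half-plane with the needed boundary points attached; 0 avoids
      the closed cuts because \<open>cut_a\<close> is positive here.\<close>
    define T where "T = {z. Im z > 0} \<union> (of_real ` {cut_b qp qm<..} \<union> {0})"
    have T_cuts: "z \<notin> closed_cuts qp qm" if "z \<in> T" for z
      using that a cuts_nonneg(2)[of qp qm] unfolding T_def closed_cuts_def by auto
    have oc: "open_cuts qp qm \<subseteq> closed_cuts qp qm"
      unfolding open_cuts_def closed_cuts_def by (intro image_mono) auto
    have U_real: "z \<in> closed_cuts qp qm" if "U z = of_real u" "u\<^sup>2 \<le> p" for z u
      using Q_in_cut(1)[OF q, of z "u + s"] that by (simp add: U_def s_def p_def algebra_simps)
    have U0: "U z \<noteq> 0" if "z \<in> T" for z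
      using U_real[of z 0] T_cuts[OF that] p by auto
    \<comment> \<open>A purely imaginary quotient would give
      \<open>U\<^sup>2 = p / (1 + t\<^sup>2)\<close> with \<open>t\<close> real, which puts
      \<open>z\<close> on the closed cuts.\<close>
    have ReG: "Re (R z / U z) \<noteq> 0" if z: "z \<in> T" for z
    proof
      assume "Re (R z / U z) = 0"
      then obtain t where t: "R z / U z = \<i> * of_real t"
        by (metis complex_eq of_real_0 add_0)
      have "(R z)\<^sup>2 = (U z)\<^sup>2 - of_real p"
        using sq[of z] T_cuts[OF z] oc by (auto simp: Wfun_eq U_def s_def p_def)
      moreover have "(R z)\<^sup>2 = (\<i> * of_real t)\<^sup>2 * (U z)\<^sup>2"
        using t U0[OF z] by (simp add: field_simps power2_eq_square)
      ultimately have "of_real (1 + t\<^sup>2) * (U z)\<^sup>2 = of_real p"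
        by (simp add: power_mult_distrib algebra_simps)
      moreover have t1: "1 + t\<^sup>2 > 0" by (simp add: add_pos_nonneg)
      ultimately have "(U z)\<^sup>2 = of_real (p / (1 + t\<^sup>2))"
        by (metis nonzero_mult_div_cancel_left of_real_divide of_real_eq_0_iff less_irrefl)
      also have "\<dots> = (of_real (sqrt (p / (1 + t\<^sup>2))))\<^sup>2"
        using p t1 by (simp flip: of_real_power)
      finally have "U z = of_real (sqrt (p / (1 + t\<^sup>2))) \<or> U z = of_real (- sqrt (p / (1 + t\<^sup>2)))"
        by (auto simp: power2_eq_iff)
      moreover have "p / (1 + t\<^sup>2) \<le> p" "0 \<le> p / (1 + t\<^sup>2)"
        using p t1 by (simp_all add: divide_le_eq)
      ultimately have "z \<in> closed_cuts qp qm"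
        using U_real[of z] by (metis power2_minus real_sqrt_pow2)
      then show False using T_cuts[OF z] by simp
    qed
    have conn: "connected T"
    proof (rule connected_intermediate_closure)
      show "connected {z. Im z > 0}" using convex_halfspace_Im_gt by (rule convex_connected)
      show "{z. Im z > 0} \<subseteq> T" by (auto simp: T_def)
      have "of_real x \<in> closure {z. Im z > 0}" for x
        unfolding closure_approachable
      proof (intro allI impI)
        fix e :: real assume "e > 0"
        then show "\<exists>y\<in>{z. Im z > 0}. dist y (of_real x) < e"
          by (intro bexI[of _ "of_real x + \<i> * of_real (e / 2)"]) (auto simp: dist_norm norm_mult)
      qed
      from this[of 0] this show "T \<subseteq> closure {z. Im z > 0}"
        using closure_subset[of "{z. Im z > 0}"] by (auto simp: T_def)
    qed
    have "continuous_on T (\<lambda>z. Re (R z / U z))"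
    proof (intro continuous_intros)
      show "continuous_on T R"
        using R T_cuts oc unfolding sqrtW_determination_def by (blast intro: continuous_on_subset)
      show "continuous_on T U" unfolding U_def Qfun_def by (intro continuous_intros)
    qed (use U0 in blast)
    then have im: "connected ((\<lambda>z. Re (R z / U z)) ` T)"
      using conn by (rule connected_continuous_image)
    \<comment> \<open>Any real point to the right of the cuts would do: \<open>R\<close> and
      \<open>U\<close> are both positive there.\<close>
    define x where "x = cut_b qp qm + 1"
    have xT: "of_real x \<in> T" unfolding T_def by (intro UnI2 UnI1 imageI) (simp add: x_def)
    obtain y where y: "y > 0" "R (of_real x) = of_real y"
      using R unfolding sqrtW_determination_def x_def by (metis less_add_one)
    define N where "N = (real qp + 1) * (real qm + 1)"
    have N: "N > 0" by (simp add: N_def add_pos_nonneg)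
    have "N * (cut_b qp qm)\<^sup>2 < N * x\<^sup>2"
      using N cuts_nonneg[of qp qm] by (simp add: x_def power_strict_mono)
    then have u: "N * x\<^sup>2 - s > 0"
      using cut_b_square[of qp qm] by (simp add: N_def s_def add_increasing2 algebra_simps)
        (smt (verit) mult_nonneg_nonneg of_nat_0_le_iff real_sqrt_ge_zero)
    have "U (of_real x) = of_real (N * x\<^sup>2 - s)" by (simp add: U_def Qfun_def N_def)
    then have "R (of_real x) / U (of_real x) = of_real (y / (N * x\<^sup>2 - s))" using y by simp
    then have pos: "Re (R (of_real x) / U (of_real x)) > 0" using y u by simp
    have "Re (R 0 / U 0) > 0"
    proof (rule ccontr)
      assume "\<not> Re (R 0 / U 0) > 0"
      moreover have "0 \<in> T" by (simp add: T_def)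
      ultimately have "0 \<in> (\<lambda>z. Re (R z / U z)) ` T"
        using connectedD_interval[OF im, of "Re (R 0 / U 0)" "Re (R (of_real x) / U (of_real x))" 0]
          pos xT by auto
      then show False using ReG by auto
    qed
    moreover have "U 0 = - of_real s" by (simp add: U_def Qfun_def)
    ultimately have "Re (R 0) < 0" using s by (simp add: zero_less_divide_iff divide_less_0_iff)
    then show ?thesis using R0 by (auto simp: power2_eq_iff)
  qed
qed

text \<open>With \<open>P = qp * qm\<close>, the strict inequality \<open>2 * sqrt P < P + 1\<close>
  places 1 to the right of the cuts, where \<open>R\<close> is the positive root of
  \<open>W\<close>, and \<open>W\<close> at 1 is \<open>(P - 1)\<^sup>2\<close>.\<close>

lemma sqrtW_determination_at_1:
  assumes q: "qp \<ge> 2" "qm \<ge> 2" and R: "sqrtW_determination qp qm R"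
  shows "R 1 = of_nat qp * of_nat qm - 1"
proof -
  define P where "P = real qp * real qm"
  have "2 * 2 \<le> P" unfolding P_def using q by (intro mult_mono) auto
  then have P: "P > 1" by simp
  define N where "N = (real qp + 1) * (real qm + 1)"
  have N: "N > 0" by (simp add: N_def add_pos_nonneg)
  have "(sqrt P - 1)\<^sup>2 > 0" using P by auto
  then have "2 * sqrt P < P + 1" using P by (simp add: power2_eq_square algebra_simps)
  then have "N * (cut_b qp qm)\<^sup>2 < N * 1"
    using cut_b_square[of qp qm] by (simp add: N_def P_def algebra_simps)
  then have "(cut_b qp qm)\<^sup>2 < 1\<^sup>2" using N by simp
  then have b: "cut_b qp qm < 1" by (rule power_less_imp_less_base) simp
  then obtain y where y: "y > 0" "R 1 = of_real y"
    using R unfolding sqrtW_determination_def by (metis of_real_1)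
  have "1 \<notin> open_cuts qp qm" using b cuts_nonneg[of qp qm] unfolding open_cuts_def by auto
  then have "(R 1)\<^sup>2 = Wfun qp qm 1" using R unfolding sqrtW_determination_def by auto
  also have "\<dots> = of_real ((P - 1)\<^sup>2)"
    by (simp add: Wfun_def Qfun_def P_def power2_eq_square algebra_simps)
  finally have "y\<^sup>2 = (P - 1)\<^sup>2" unfolding y by (metis of_real_eq_iff of_real_power)
  then have "y = P - 1" using y P by (simp add: power2_eq_iff)
  then show ?thesis using y by (simp add: P_def)
qed

lemma Ftplus_at_1:
  assumes "qp \<ge> 2" "qm \<ge> 2" "R 1 = of_nat qp * of_nat qm - 1"
  shows "Ftplus qp qm R 1 = 1"
proof -
  have "Qfun qp qm 1 - (of_nat qp - of_nat qm) + R 1 = 2 * of_nat qm * (of_nat qp + 1)"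
    unfolding assms(3) by (simp add: Qfun_def algebra_simps)
  then show ?thesis
    unfolding Ftplus_def using assms of_nat_add_one_neq_0[of qp] by simp
qed

lemma Ftminus_at_1:
  assumes "qp \<ge> 2" "qm \<ge> 2" "R 1 = of_nat qp * of_nat qm - 1"
  shows "Ftminus qp qm R 1 = 1"
  using Ftplus_at_1[of qm qp R] assms by (simp add: Ftplus_swap mult.commute)

section \<open>Limits at 0\<close>

text \<open>\<open>A\<close> will be the complement of the spectrum. Continuity off the open cuts
  covers \<open>qp = qm\<close> too, where 0 is an end of both cuts.\<close>

lemma R_tendsto:
  assumes q: "qp > 0" "qm > 0" and R: "sqrtW_determination qp qm R" and A: "A \<inter> open_cuts qp qm = {}"
  shows "(R \<longlongrightarrow> - of_real \<bar>real qp - real qm\<bar>) (at 0 within A)"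
proof -
  have "(R \<longlongrightarrow> R 0) (at 0 within - open_cuts qp qm)"
    using R zero_notin_open_cuts unfolding sqrtW_determination_def continuous_on_def by auto
  then show ?thesis
    unfolding sqrtW_determination_at_0[OF q R] using A by (blast intro: tendsto_within_subset)
qed

lemma Qfun_tendsto: "(Qfun qp qm \<longlongrightarrow> 0) (at 0 within A)"
proof -
  have "(Qfun qp qm \<longlongrightarrow> (of_nat qp + 1) * (of_nat qm + 1) * 0\<^sup>2) (at 0 within A)"
    unfolding Qfun_def by (intro tendsto_intros)
  then show ?thesis by simp
qed

lemma eventually_determination:
  assumes R: "sqrtW_determination qp qm R" and A: "A \<inter> open_cuts qp qm = {}"
  shows "\<forall>\<^sub>F \<gamma> in at 0 within A. \<gamma> \<noteq> 0 \<and> (R \<gamma>)\<^sup>2 = Wfun qp qm \<gamma>"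
  unfolding eventually_at_filter
  using R A unfolding sqrtW_determination_def by (auto intro!: always_eventually)

lemma Fplus_mult_Fminus_tendsto:
  assumes q: "qp > 0" "qm > 0" and R: "sqrtW_determination qp qm R" and A: "A \<inter> open_cuts qp qm = {}"
  shows "((\<lambda>\<gamma>. Fplus qp qm R \<gamma> * Fminus qp qm R \<gamma>) \<longlongrightarrow> - (1 / of_nat (max qp qm))) (at 0 within A)"
proof -
  let ?d = "complex_of_real \<bar>real qp - real qm\<bar>"
  have "((\<lambda>\<gamma>. (Qfun qp qm \<gamma> - R \<gamma> - (of_nat qp + of_nat qm)) / (2 * of_nat qp * of_nat qm)) \<longlongrightarrow>
      (0 - (- ?d) - (of_nat qp + of_nat qm)) / (2 * of_nat qp * of_nat qm)) (at 0 within A)"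
    using q by (intro tendsto_intros Qfun_tendsto R_tendsto[OF q R A]) auto
  \<comment> \<open>The numerator is \<open>- 2 * min qp qm\<close>, and the product of the degrees
    is \<open>min qp qm * max qp qm\<close>.\<close>
  moreover have "(0 - (- ?d) - (of_nat qp + of_nat qm)) / (2 * of_nat qp * of_nat qm) =
      - (1 / of_nat (max qp qm))"
    using q by (cases "qp \<le> qm") (auto simp: max_def field_simps)
  ultimately have "((\<lambda>\<gamma>. (Qfun qp qm \<gamma> - R \<gamma> - (of_nat qp + of_nat qm)) / (2 * of_nat qp * of_nat qm)) \<longlongrightarrow>
      - (1 / of_nat (max qp qm))) (at 0 within A)" by simp
  moreover have "\<forall>\<^sub>F \<gamma> in at 0 within A.
      (Qfun qp qm \<gamma> - R \<gamma> - (of_nat qp + of_nat qm)) / (2 * of_nat qp * of_nat qm) =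
      Fplus qp qm R \<gamma> * Fminus qp qm R \<gamma>"
    using eventually_determination[OF R A] by eventually_elim (use Fplus_mult_Fminus[OF q] in auto)
  ultimately show ?thesis by (rule Lim_transform_eventually)
qed

lemma divide_linear_at_infinity:
  fixes c l :: complex
  assumes "(f \<longlongrightarrow> l) (at 0 within A)" "l \<noteq> 0" "c \<noteq> 0"
  shows "filterlim (\<lambda>\<gamma>. f \<gamma> / (c * \<gamma>)) at_infinity (at 0 within A)"
proof (rule filterlim_divide_at_infinity[OF assms(1) _ assms(2)])
  have "((\<lambda>\<gamma>. c * \<gamma>) \<longlongrightarrow> c * 0) (at 0 within A)" by (intro tendsto_intros)
  then show "filterlim (\<lambda>\<gamma>. c * \<gamma>) (at 0) (at 0 within A)"
    using assms(3) by (auto simp: filterlim_at eventually_at_filter)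
qed

text \<open>The numerator tends to \<open>2 * (qp - qm)\<close>, which is nonzero, while the
  denominator vanishes at 0.\<close>

lemma Fminus_at_infinity:
  assumes q: "qm > 0" "qp > qm" and R: "sqrtW_determination qp qm R" and A: "A \<inter> open_cuts qp qm = {}"
  shows "filterlim (Fminus qp qm R) at_infinity (at 0 within A)"
  unfolding Fminus_def
proof (rule divide_linear_at_infinity)
  show "((\<lambda>\<gamma>. Qfun qp qm \<gamma> + (of_nat qp - of_nat qm) - R \<gamma>) \<longlongrightarrow>
      0 + (of_nat qp - of_nat qm) - (- of_real \<bar>real qp - real qm\<bar>)) (at 0 within A)"
    using q by (intro tendsto_intros Qfun_tendsto R_tendsto[OF _ _ R A]) auto
qed (use q of_nat_add_one_neq_0 in auto)

text \<open>Here numerator and denominator both tend to 0. The companion \<open>Ftminus\<close> has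
  a nonzero limit in its numerator, so it tends to infinity, and its product with
  \<open>Fminus\<close> is constant.\<close>

lemma Fminus_tendsto_0:
  assumes q: "qp > 0" "qp < qm" and R: "sqrtW_determination qp qm R" and A: "A \<inter> open_cuts qp qm = {}"
  shows "(Fminus qp qm R \<longlongrightarrow> 0) (at 0 within A)"
proof -
  have lim: "filterlim (Ftminus qp qm R) at_infinity (at 0 within A)"
    unfolding Ftminus_def
  proof (rule divide_linear_at_infinity)
    show "((\<lambda>\<gamma>. Qfun qp qm \<gamma> + (of_nat qp - of_nat qm) + R \<gamma>) \<longlongrightarrow>
        0 + (of_nat qp - of_nat qm) + (- of_real \<bar>real qp - real qm\<bar>)) (at 0 within A)"
      using q by (intro tendsto_intros Qfun_tendsto R_tendsto[OF _ _ R A]) auto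
  qed (use q of_nat_add_one_neq_0 in auto)
  define c :: complex where "c = (of_nat qp + 1) / (of_nat qp * (of_nat qm + 1))"
  have c: "c \<noteq> 0" using q of_nat_add_one_neq_0[of qp] of_nat_add_one_neq_0[of qm] by (simp add: c_def)
  have "((\<lambda>\<gamma>. c / Ftminus qp qm R \<gamma>) \<longlongrightarrow> 0) (at 0 within A)"
    by (rule tendsto_divide_0[OF tendsto_const lim])
  moreover have "\<forall>\<^sub>F \<gamma> in at 0 within A. c / Ftminus qp qm R \<gamma> = Fminus qp qm R \<gamma>"
    using eventually_determination[OF R A]
  proof eventually_elim
    case (elim \<gamma>)
    then have "Fminus qp qm R \<gamma> * Ftminus qp qm R \<gamma> = c"
      using Fminus_mult_Ftminus[of qp qm \<gamma> R] q by (simp add: c_def)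
    then show ?case using c by (metis mult_eq_0_iff nonzero_mult_div_cancel_right)
  qed
  ultimately show ?thesis by (rule Lim_transform_eventually)
qed

section \<open>The generalized Poisson kernels\<close>

lemma kernel_even:
  fixes a b :: complex
  assumes "even h"
  shows "a powi (- ((h + 1) div 2)) * b powi (- (h div 2)) = (a * b) powi (- (h div 2))"
proof -
  have "(h + 1) div 2 = h div 2" using assms by presburger
  then show ?thesis by (simp add: power_int_mult_distrib)
qed

lemma kernel_odd:
  fixes a b :: complex
  assumes "odd h" "a \<noteq> 0" "b \<noteq> 0"
  shows "a powi (- ((h + 1) div 2)) * b powi (- (h div 2)) = (a * b) powi (- ((h - 1) div 2)) / a"
    and "a powi (- ((h + 1) div 2)) * b powi (- (h div 2)) = (a * b) powi (- ((h + 1) div 2)) * b"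
proof -
  define k where "k = h div 2"
  have k: "- (h div 2) = - k" "- ((h - 1) div 2) = - k" "- ((h + 1) div 2) = - k - 1"
    unfolding k_def using assms(1) by presburger+
  show "a powi (- ((h + 1) div 2)) * b powi (- (h div 2)) = (a * b) powi (- ((h - 1) div 2)) / a"
    and "a powi (- ((h + 1) div 2)) * b powi (- (h div 2)) = (a * b) powi (- ((h + 1) div 2)) * b"
    unfolding k using assms(2,3) by (simp_all add: power_int_diff power_int_mult_distrib)
qed

text \<open>The kernel is multiplicative in the pair of edge values, so the two kernels multiply to
  the kernel of \<open>e\<close> and \<open>e'\<close>. As \<open>e * e'\<close> is the inverse of
  \<open>q\<^sup>2\<close>, this is a power of \<open>q\<close>, with an extra factor
  \<open>1 / e = q * r\<close> for odd \<open>h\<close>.\<close>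

lemma companion_kernel:
  fixes a b a' b' e e' q r :: complex
  assumes nz: "a \<noteq> 0" "b \<noteq> 0" "e \<noteq> 0" "e' \<noteq> 0" "q \<noteq> 0"
    and prods: "a * a' = e" "b * b' = e'" and q: "q\<^sup>2 * (e * e') = 1" and r: "q * r * e = 1"
  defines "K \<equiv> \<lambda>h x y. x powi (- ((h + 1) div 2)) * y powi (- (h div 2)) :: complex"
  shows "even h \<Longrightarrow> K h a' b' = q powi h / K h a b"
    and "odd h \<Longrightarrow> K h a' b' = q powi h / K h a b * r"
proof -
  have K0: "K h a b \<noteq> 0" using nz by (simp add: K_def)
  have "K h a' b' * K h a b = (a * a') powi (- ((h + 1) div 2)) * (b * b') powi (- (h div 2))"
    by (simp add: K_def power_int_mult_distrib)
  also have "\<dots> = K h e e'" by (simp add: K_def prods)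
  finally have KK: "K h a' b' = K h e e' / K h a b" using K0 by (simp add: field_simps)
  have "(e * e') powi (h div 2) * (q\<^sup>2) powi (h div 2) = 1"
    unfolding power_int_mult_distrib[symmetric] using q by (simp add: mult.commute)
  then have ee: "(e * e') powi (- (h div 2)) = (q\<^sup>2) powi (h div 2)"
    unfolding power_int_minus by (rule inverse_unique)
  have q2: "(q\<^sup>2) powi (h div 2) = q powi (2 * (h div 2))"
    by (simp add: power_int_mult)
  show "K h a' b' = q powi h / K h a b" if "even h"
    unfolding KK using that kernel_even[OF that, of e e'] by (simp add: K_def ee q2)
  show "K h a' b' = q powi h / K h a b * r" if "odd h"
  proof -
    have "q powi h = q powi (2 * (h div 2) + 1)" using that by simp
    then have "q powi h = q powi (2 * (h div 2)) * q" using nz by (simp add: power_int_add)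
    moreover have "(h - 1) div 2 = h div 2" using that by presburger
    then have "K h e e' = q powi (2 * (h div 2)) * (1 / e)"
      using kernel_odd(1)[OF that nz(3,4)] by (simp add: K_def ee q2)
    moreover have "1 / e = q * r" using r nz by (simp add: field_simps)
    ultimately show ?thesis unfolding KK by simp
  qed
qed

lemma companion_constants:
  assumes "qp > 0" "qm > 0"
  defines "q \<equiv> complex_of_real (sqrt (real qp * real qm))"
    and "e \<equiv> (of_nat qm + 1) / (of_nat qm * (of_nat qp + 1)) :: complex"
    and "e' \<equiv> (of_nat qp + 1) / (of_nat qp * (of_nat qm + 1)) :: complex"
    and "r \<equiv> complex_of_real (sqrt (real qm) * (real qp + 1) / (sqrt (real qp) * (real qm + 1)))"
  shows "e \<noteq> 0" "e' \<noteq> 0" "q \<noteq> 0" "q\<^sup>2 * (e * e') = 1" "q * r * e = 1"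
proof -
  note nz = of_nat_add_one_neq_0[of qp] of_nat_add_one_neq_0[of qm]
  show "e \<noteq> 0" "e' \<noteq> 0" "q \<noteq> 0" using assms(1,2) nz by (simp_all add: e_def e'_def q_def)
  have "q\<^sup>2 = of_real (real qp * real qm)"
    unfolding q_def of_real_power[symmetric] by simp
  then show "q\<^sup>2 * (e * e') = 1" using assms(1,2) nz by (simp add: e_def e'_def)
  have "sqrt (real qp * real qm) * (sqrt (real qm) * (real qp + 1) / (sqrt (real qp) * (real qm + 1))) =
      (sqrt (real qm))\<^sup>2 * (real qp + 1) / (real qm + 1)"
    using assms(1,2) unfolding real_sqrt_mult power2_eq_square by simp
  also have "\<dots> = real qm * (real qp + 1) / (real qm + 1)" by simp
  finally have "q * r = of_nat qm * (of_nat qp + 1) / (of_nat qm + 1)"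
    unfolding q_def r_def of_real_mult[symmetric] by simp
  then show "q * r * e = 1" using assms(1,2) nz by (simp add: e_def)
qed

theorem corollary6p8:
  fixes qp qm :: nat and Vp Vm :: "'v set" and E :: "('v \<times> 'v) set"
    and v0 v :: 'v and \<omega> :: "(nat \<Rightarrow> 'v) set" and R :: "complex \<Rightarrow> complex"
  assumes "2 \<le> qp" and "2 \<le> qm"
    and "semihomogeneous_tree qp qm Vp Vm E"
    and "v0 \<in> Vp"
    and "sqrtW_determination qp qm R"
    and "v \<in> Vp \<union> Vm"
    and "\<omega> \<in> boundary E"
  shows "let \<sigma> = ell2_spectrum (Vp \<union> Vm) (mu1 E);
             d = gdist E v v0;
             h = horo_index E v v0 \<omega>;
             q = complex_of_real (sqrt (real qp * real qm));
             Fp = Fplus qp qm R;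
             Fm = Fminus qp qm R;
             K = poisson_K qp qm R Vp E v v0 \<omega>;
             Kt = poisson_Kt qp qm R Vp E v v0 \<omega>
         in
           (\<forall>\<gamma>. \<gamma> \<notin> \<sigma> \<longrightarrow>
              K \<gamma> = Fp \<gamma> powi (- \<lceil>real_of_int h / 2\<rceil>) * Fm \<gamma> powi (- \<lfloor>real_of_int h / 2\<rfloor>) \<and>
              (even d \<longrightarrow> even h \<and>
                 K \<gamma> = (Fp \<gamma> * Fm \<gamma>) powi (- (h div 2))) \<and>
              (odd d \<longrightarrow> odd h \<and>
                 K \<gamma> = (Fp \<gamma> * Fm \<gamma>) powi (- ((h - 1) div 2)) / Fp \<gamma> \<and>
                 K \<gamma> = (Fp \<gamma> * Fm \<gamma>) powi (- ((h + 1) div 2)) * Fm \<gamma>)) \<and>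
           (v \<in> Vp \<longrightarrow>
              (K \<longlongrightarrow> (- (1 / of_nat (max qp qm))) powi (- (h div 2))) (at 0 within - \<sigma>)) \<and>
           (v \<in> Vm \<and> qp < qm \<longrightarrow> (K \<longlongrightarrow> 0) (at 0 within - \<sigma>)) \<and>
           (v \<in> Vm \<and> qp > qm \<longrightarrow> filterlim K at_infinity (at 0 within - \<sigma>)) \<and>
           (\<forall>\<gamma>. \<gamma> \<notin> \<sigma> \<longrightarrow>
              (even d \<longrightarrow> Kt \<gamma> = q powi h / K \<gamma>) \<and>
              (odd d \<longrightarrow> Kt \<gamma> = q powi h / K \<gamma> *
                 complex_of_real (sqrt (real qm) * (real qp + 1) / (sqrt (real qp) * (real qm + 1))))) \<and>
           Kt 1 = 1"
proof -
  have q: "qp > 0" "qm > 0" using assms(1,2) by simp_all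
  interpret bitree qp qm Vp Vm E by unfold_locales (rule assms(3))
  define \<sigma> where "\<sigma> = ell2_spectrum (Vp \<union> Vm) (mu1 E)"
  define h where "h = horo_index E v v0 \<omega>"
  define K where "K = poisson_K qp qm R Vp E v v0 \<omega>"
  define Kt where "Kt = poisson_Kt qp qm R Vp E v v0 \<omega>"
  define Fp Fm where "Fp = Fplus qp qm R" and "Fm = Fminus qp qm R"
  define A where "A = - \<sigma>"
  have A: "A \<inter> open_cuts qp qm = {}"
    using open_cuts_in_spectrum[OF q assms(4)] by (auto simp: A_def \<sigma>_def)
  have A0: "\<gamma> \<noteq> 0" and AW: "(R \<gamma>)\<^sup>2 = Wfun qp qm \<gamma>" if "\<gamma> \<notin> \<sigma>" for \<gamma>
  proof -
    show "\<gamma> \<noteq> 0" using zero_in_spectrum[OF q assms(4)] that by (auto simp: \<sigma>_def)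
    have "\<gamma> \<notin> open_cuts qp qm" using A that by (auto simp: A_def)
    then show "(R \<gamma>)\<^sup>2 = Wfun qp qm \<gamma>" using assms(5) unfolding sqrtW_determination_def by auto
  qed
  note const = companion_constants[OF q]
  have FF: "Fp \<gamma> * Ftplus qp qm R \<gamma> = (of_nat qm + 1) / (of_nat qm * (of_nat qp + 1))"
    "Fm \<gamma> * Ftminus qp qm R \<gamma> = (of_nat qp + 1) / (of_nat qp * (of_nat qm + 1))" if "\<gamma> \<notin> \<sigma>" for \<gamma>
    using Fplus_mult_Ftplus[where R = R, OF q A0[OF that] AW[OF that]]
      Fminus_mult_Ftminus[where R = R, OF q A0[OF that] AW[OF that]]
    by (simp_all only: Fp_def Fm_def)
  \<comment> \<open>Each edge value divides a nonzero constant, so none of them vanishes.\<close>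
  have nz: "Fp \<gamma> \<noteq> 0" "Fm \<gamma> \<noteq> 0" "Ftplus qp qm R \<gamma> \<noteq> 0" "Ftminus qp qm R \<gamma> \<noteq> 0" if "\<gamma> \<notin> \<sigma>" for \<gamma>
    using FF[OF that] const(1,2) by (metis mult_zero_left mult_zero_right)+
  have hpar: "even h \<longleftrightarrow> v \<in> Vp"
    unfolding h_def by (rule horo_index_parity[OF assms(7,6,4)])
  have dpar: "even (gdist E v v0) \<longleftrightarrow> v \<in> Vp"
    using gdist_parity[of v v0] assms(4,6) by auto
  have K: "K \<gamma> = Fp \<gamma> powi (- ((h + 1) div 2)) * Fm \<gamma> powi (- (h div 2))" if "\<gamma> \<notin> \<sigma>" for \<gamma>
    using chain_kernel_eq[OF assms(7,6,4)] nz(1,2)[OF that]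
    unfolding K_def poisson_K_def Fp_def Fm_def h_def by blast
  \<comment> \<open>Conditional on nonzero edge values rather than on the spectrum, so that it also
    applies at 1, where both values are 1.\<close>
  have Kt: "Kt \<gamma> = Ftplus qp qm R \<gamma> powi (- ((h + 1) div 2)) * Ftminus qp qm R \<gamma> powi (- (h div 2))"
    if "Ftplus qp qm R \<gamma> \<noteq> 0" "Ftminus qp qm R \<gamma> \<noteq> 0" for \<gamma>
    using chain_kernel_eq[OF assms(7,6,4)] that
    unfolding Kt_def poisson_Kt_def h_def by blast
  have even: "K \<gamma> = (Fp \<gamma> * Fm \<gamma>) powi (- (h div 2))" if "\<gamma> \<notin> \<sigma>" "even h" for \<gamma>
    unfolding K[OF that(1)] by (rule kernel_even[OF that(2)])
  have odd: "K \<gamma> = (Fp \<gamma> * Fm \<gamma>) powi (- ((h - 1) div 2)) / Fp \<gamma>"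
    "K \<gamma> = (Fp \<gamma> * Fm \<gamma>) powi (- ((h + 1) div 2)) * Fm \<gamma>" if "\<gamma> \<notin> \<sigma>" "odd h" for \<gamma>
    unfolding K[OF that(1)] by (rule kernel_odd[OF that(2) nz(1,2)[OF that(1)]])+
  have "\<lceil>real_of_int h / 2\<rceil> = (h + 1) div 2" "\<lfloor>real_of_int h / 2\<rfloor> = h div 2"
    by linarith+
  then have formula: "K \<gamma> = Fp \<gamma> powi (- \<lceil>real_of_int h / 2\<rceil>) * Fm \<gamma> powi (- \<lfloor>real_of_int h / 2\<rfloor>)"
    if "\<gamma> \<notin> \<sigma>" for \<gamma>
    using K[OF that] by simp
  have ev: "\<forall>\<^sub>F \<gamma> in at 0 within A. \<gamma> \<notin> \<sigma>"
    by (simp add: eventually_at_filter A_def)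
  have m: "- (1 / of_nat (max qp qm)) \<noteq> (0 :: complex)" using q by (simp add: max_def)
  note FpFm = Fplus_mult_Fminus_tendsto[OF q assms(5) A, folded Fp_def Fm_def]
  have powi: "((\<lambda>\<gamma>. (Fp \<gamma> * Fm \<gamma>) powi n) \<longlongrightarrow> (- (1 / of_nat (max qp qm))) powi n) (at 0 within A)" for n
    using FpFm m by (rule tendsto_power_int)
  have lim_plus: "(K \<longlongrightarrow> (- (1 / of_nat (max qp qm))) powi (- (h div 2))) (at 0 within A)" if "v \<in> Vp"
    by (rule Lim_transform_eventually[OF powi])
      (use ev in eventually_elim, use even hpar that in simp)
  \<comment> \<open>Of the two odd forms this one isolates \<open>Fm\<close>: the power of
    \<open>Fp * Fm\<close> has a finite nonzero limit, so \<open>Fm\<close> alone decides between 0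
    and infinity.\<close>
  have ev_minus: "\<forall>\<^sub>F \<gamma> in at 0 within A. (Fp \<gamma> * Fm \<gamma>) powi (- ((h + 1) div 2)) * Fm \<gamma> = K \<gamma>"
    if "v \<in> Vm"
  proof -
    have "odd h" using that hpar disjoint by auto
    from ev show ?thesis by eventually_elim (use odd(2)[OF _ \<open>odd h\<close>] in simp)
  qed
  have lim_zero: "(K \<longlongrightarrow> 0) (at 0 within A)" if "v \<in> Vm" "qp < qm"
  proof -
    have "((\<lambda>\<gamma>. (Fp \<gamma> * Fm \<gamma>) powi (- ((h + 1) div 2)) * Fm \<gamma>) \<longlongrightarrow> 0) (at 0 within A)"
      using tendsto_mult[OF powi Fminus_tendsto_0[OF q(1) that(2) assms(5) A]]
      by (simp add: Fm_def)
    then show ?thesis using ev_minus[OF that(1)] by (rule Lim_transform_eventually)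
  qed
  have lim_inf: "filterlim K at_infinity (at 0 within A)" if "v \<in> Vm" "qp > qm"
  proof -
    have "filterlim (\<lambda>\<gamma>. (Fp \<gamma> * Fm \<gamma>) powi (- ((h + 1) div 2)) * Fm \<gamma>) at_infinity (at 0 within A)"
      using Fminus_at_infinity[OF q(2) that(2) assms(5) A] power_int_not_zero[OF disjI1[OF m]]
      by (intro tendsto_mult_filterlim_at_infinity[OF powi]) (simp_all only: Fm_def not_False_eq_True)
    then show ?thesis using filterlim_cong[OF refl refl ev_minus[OF that(1)]] by blast
  qed
  have companion: "even h \<Longrightarrow> Kt \<gamma> = complex_of_real (sqrt (real qp * real qm)) powi h / K \<gamma>"
    "odd h \<Longrightarrow> Kt \<gamma> = complex_of_real (sqrt (real qp * real qm)) powi h / K \<gamma> *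
      complex_of_real (sqrt (real qm) * (real qp + 1) / (sqrt (real qp) * (real qm + 1)))"
    if "\<gamma> \<notin> \<sigma>" for \<gamma>
    unfolding K[OF that] Kt[OF nz(3,4)[OF that]]
    by (fact companion_kernel[OF nz(1,2)[OF that] const(1-3) FF[OF that] const(4,5)])+
  have R1: "R 1 = of_nat qp * of_nat qm - 1"
    by (rule sqrtW_determination_at_1[OF assms(1,2,5)])
  have Kt1: "Kt 1 = 1"
    using Kt[of 1] Ftplus_at_1[where R = R, OF assms(1,2) R1] Ftminus_at_1[where R = R, OF assms(1,2) R1] by simp
  show ?thesis
    unfolding Let_def \<sigma>_def[symmetric] h_def[symmetric] K_def[symmetric] Kt_def[symmetric]
      Fp_def[symmetric] Fm_def[symmetric] A_def[symmetric]
    using formula even odd hpar dpar lim_plus lim_zero lim_inf companion Kt1 by blast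
qed

end
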